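(* For $c>0$ let $\mu^c$ be the limiting normalised spectral measure of the Erdős–Rényi random graphs $G(n,c/n)$ as $n\to\infty$ (defined in the context). Then for every integer $k\ge 0$, as $c\to\infty$, $$m_k(\mu^c)=m_k\left(\sigma+\frac1c\,\sigma^{\{1\}}\right)+o\left(\frac1c\right),$$ where $\sigma$ is the semi-circle law with density $\frac{1}{2\pi}\sqrt{4-x^2}\,\mathbf 1_{|x|<2}$ and $\sigma^{\{1\}}$ is the signed measure with total mass $0$ and density $$\frac{1}{2\pi}\,\frac{x^4-4x^2+2}{\sqrt{4-x^2}}\,\mathbf 1_{|x|<2}.$$
   Context: For a (possibly signed) measure $\mu$ on $\mathbb R$ with $\int |x|^k\,|d\mu(x)|<\infty$, $m_k(\mu)=\int x^k\,d\mu(x)$ denotes its moment of order $k$. For $c>0$ and $n\ge c$, let $X_n$ be the adjacency matrix of the Erdős–Rényi random graph $G(n,c/n)$: a symmetric $n\times n$ random matrix with zero diagonal whose entries above the diagonal are i.i.d. Bernoulli with parameter $c/n$. The normalised spectral measure is $$\mu_n^c=\frac1n\sum_{\lambda\in \mathrm{Sp}(c^{-1/2}X_n)}\delta_\lambda$$ (eigenvalues counted with multiplicity). It is a known fact that, for fixed $c$, $\mu_n^c$ converges weakly as $n\to\infty$ (in probability, and also after taking expectations) to a deterministic probability measure on $\mathbb R$; this limit is denoted $\mu^c$. *)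

theory Defs
  imports "HOL-Probability.Probability" "HOL-Library.Landau_Symbols"
    "Jordan_Normal_Form.Char_Poly"
begin

definition moment :: "nat \<Rightarrow> real measure \<Rightarrow> real" where
  "moment k M = (LINT x|M. x ^ k)"

text \<open>
  There is no library type of signed measures. The signed measures used here are absolutely
  continuous, and such a measure is represented by its (signed) Lebesgue density \<open>f\<close>; integrating
  \<open>g\<close> against it means integrating \<open>g \<cdot> f\<close> against Lebesgue measure.
\<close>

definition signed_moment :: "nat \<Rightarrow> (real \<Rightarrow> real) \<Rightarrow> real" where
  "signed_moment k f = (LINT x|lborel. x ^ k * f x)"

definition has_signed_moment :: "nat \<Rightarrow> (real \<Rightarrow> real) \<Rightarrow> bool" where
  "has_signed_moment k f \<longleftrightarrow> integrable lborel (\<lambda>x. x ^ k * f x)"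

definition semicircle_density :: "real \<Rightarrow> real" where
  "semicircle_density x = (if \<bar>x\<bar> < 2 then 1 / (2 * pi) * sqrt (4 - x\<^sup>2) else 0)"

definition semicircle_correction_density :: "real \<Rightarrow> real" where
  "semicircle_correction_density x =
     (if \<bar>x\<bar> < 2 then 1 / (2 * pi) * ((x ^ 4 - 4 * x\<^sup>2 + 2) / sqrt (4 - x\<^sup>2)) else 0)"

definition adjacency_matrix :: "nat \<Rightarrow> (nat \<times> nat \<Rightarrow> bool) \<Rightarrow> real mat" where
  "adjacency_matrix n e =
     Matrix.mat n n (\<lambda>(i, j). if i = j then 0 else of_bool (e (min i j, max i j)))"

text \<open>
  The law of the adjacency matrix of \<open>G(n, p)\<close>: the entries above the diagonal are independent
  Bernoulli variables. For \<open>p \<notin> {0..1}\<close> the parameter of \<^const>\<open>bernoulli_pmf\<close> is clamped;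
  with \<open>p = c / n\<close> this only affects the indices \<open>n < c\<close>, which no limit depends on.
\<close>

definition erdos_renyi :: "nat \<Rightarrow> real \<Rightarrow> real mat pmf" where
  "erdos_renyi n p =
     map_pmf (adjacency_matrix n)
       (Pi_pmf {(i, j). i < j \<and> j < n} False (\<lambda>_. bernoulli_pmf p))"

text \<open>
  The uniform distribution on the multiset of eigenvalues, counted with multiplicity as roots of
  the characteristic polynomial. A symmetric real \<open>n \<times> n\<close> matrix has exactly \<open>n\<close> real eigenvalues,
  so for it each eigenvalue gets weight \<open>1 / n\<close> times its multiplicity.
\<close>

definition spectral_pmf :: "real mat \<Rightarrow> real pmf" where
  "spectral_pmf A = pmf_of_multiset (proots (char_poly A))"

definition normalised_spectral_pmf :: "real \<Rightarrow> real mat \<Rightarrow> real pmf" where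
  "normalised_spectral_pmf c X = spectral_pmf ((1 / sqrt c) \<cdot>\<^sub>m X)"

definition expected_spectral_measure :: "real \<Rightarrow> nat \<Rightarrow> real measure" where
  "expected_spectral_measure c n =
     distr (measure_pmf (bind_pmf (erdos_renyi n (c / real n)) (normalised_spectral_pmf c)))
       borel (\<lambda>x. x)"

definition spectral_weak_limit_in_expectation :: "real \<Rightarrow> real measure \<Rightarrow> bool" where
  "spectral_weak_limit_in_expectation c M \<longleftrightarrow> weak_conv_m (expected_spectral_measure c) M"

definition spectral_weak_limit_in_probability :: "real \<Rightarrow> real measure \<Rightarrow> bool" where
  "spectral_weak_limit_in_probability c M \<longleftrightarrow>
     (\<forall>f::real \<Rightarrow> real. continuous_on UNIV f \<longrightarrow> bounded (range f) \<longrightarrow>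
       (\<forall>\<epsilon>>0. (\<lambda>n. measure_pmf.prob (erdos_renyi n (c / real n))
                {X. \<bar>measure_pmf.expectation (normalised_spectral_pmf c X) f - (LINT x|M. f x)\<bar> > \<epsilon>})
              \<longlonglongrightarrow> 0))"

definition limiting_spectral_measure :: "real \<Rightarrow> real measure \<Rightarrow> bool" where
  "limiting_spectral_measure c M \<longleftrightarrow>
     real_distribution M \<and>
     spectral_weak_limit_in_probability c M \<and>
     spectral_weak_limit_in_expectation c M"

end

theory Submission
  imports Defs "HOL-Real_Asymp.Real_Asymp" "Jordan_Normal_Form.Schur_Decomposition"
begin

text \<open>
  The expected normalised trace of the \<open>k\<close>-th power of the adjacency matrix is a sum over closed walks
  of \<open>c / n\<close> to the number of distinct edges. As \<open>n\<close> tends to infinity only walks whose edges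
  form a tree survive, each with weight \<open>c\<close> to the number of edges; weak convergence together with
  bounded moments of all orders identifies this limit, divided by \<open>c powr (k / 2)\<close>, with the moment of the limit measure.
  Recording a walk by its depth, every step down to a vertex visited before costs a factor \<open>1 / c\<close>.
  With no such step one counts Dyck paths, which gives the moments of the semicircle law.
  With exactly one such step, a recursion on the remaining length shows that the count is the number of \<open>+1/-1\<close>
  paths of length \<open>k\<close> ending at height 4, that is, \<open>1 / pi\<close> times the integral of
  \<open>(2 * cos t) ^ k * cos (4 * t)\<close> over \<open>{0..pi}\<close>, and the substitution \<open>x = 2 * cos t\<close> turns this
  into the moment of the correction, because \<open>x ^ 4 - 4 * x ^ 2 + 2 = 2 * cos (4 * t)\<close>.
\<close>

subsection \<open>Closed walks on trees\<close>

text \<open>By \<open>cos_coeff_0\<close> and \<open>cos_coeff_Suc\<close>, this counts the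
  \<open>+1/-1\<close> paths of length \<open>s\<close> from \<open>0\<close> to \<open>j\<close>.
  The integral form makes evenness in \<open>j\<close> immediate and is what the substitution
  \<open>x = 2 * cos t\<close> produces from the densities.\<close>

definition cos_coeff :: "nat \<Rightarrow> int \<Rightarrow> real" where
  "cos_coeff s j = (1 / pi) * integral {0..pi} (\<lambda>t. (2 * cos t) ^ s * cos (of_int j * t))"

lemma cos_coeff_uminus: "cos_coeff s (- j) = cos_coeff s j"
  by (simp add: cos_coeff_def)

lemma integrable_cos_coeff:
  "(\<lambda>t. (2 * cos t) ^ s * cos (of_int j * t)) integrable_on {0..pi}"
  by (intro integrable_continuous_real continuous_intros)

lemma cos_coeff_0: "cos_coeff 0 j = of_bool (j = 0)"
proof (cases "j = 0")
  case False
  have "((\<lambda>t. cos (of_int j * t)) has_integral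
      (sin (of_int j * pi) / of_int j - sin (of_int j * 0) / of_int j)) {0..pi}"
    using False
    by (intro fundamental_theorem_of_calculus)
      (auto intro!: derivative_eq_intros simp flip: has_real_derivative_iff_has_vector_derivative)
  moreover have "sin (of_int j * pi) = 0"
    by (simp add: sin_zero_iff_int2)
  ultimately show ?thesis
    using False by (simp add: cos_coeff_def integral_unique)
qed (simp add: cos_coeff_def)

lemma cos_coeff_Suc: "cos_coeff (Suc s) j = cos_coeff s (j - 1) + cos_coeff s (j + 1)"
proof -
  have "(2 * cos t) ^ Suc s * cos (of_int j * t) =
      (2 * cos t) ^ s * cos (of_int (j - 1) * t) + (2 * cos t) ^ s * cos (of_int (j + 1) * t)" for t :: real
    by (simp add: algebra_simps cos_add cos_diff)
  then show ?thesis
    unfolding cos_coeff_def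
    by (simp only: Henstock_Kurzweil_Integration.integral_add[OF integrable_cos_coeff integrable_cos_coeff]
        distrib_left)
qed

text \<open>The reflection principle: for \<open>h \<ge> 0\<close> this counts the paths of length
  \<open>s\<close> between heights \<open>0\<close> and \<open>h\<close> that never go below
  \<open>0\<close>. Reflecting \<open>h\<close> in the level \<open>-1\<close> gives
  \<open>- h - 2\<close>, and \<open>cos_coeff\<close> is even.\<close>

definition ballot :: "nat \<Rightarrow> int \<Rightarrow> real" where
  "ballot s h = cos_coeff s h - cos_coeff s (h + 2)"

lemma ballot_Suc: "ballot (Suc s) h = ballot s (h - 1) + ballot s (h + 1)"
  by (simp add: ballot_def cos_coeff_Suc algebra_simps)

text \<open>The boundary value at the forbidden level: it makes \<open>ballot_Suc\<close> at height
  \<open>0\<close> agree with the absence of a step up at the root.\<close>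

lemma ballot_minus_1: "ballot s (- 1) = 0"
  using cos_coeff_uminus[of s 1] by (simp add: ballot_def)

text \<open>
  A partially explored plane tree is a function \<open>N\<close> giving the number of visited children of each vertex,
  a vertex being the list of child indices leading to it, innermost index first: \<open>i # a\<close> is the
  \<open>i\<close>-th child of \<open>a\<close>, and \<open>[]\<close> is the root.
\<close>

definition new_child :: "nat list \<Rightarrow> (nat list \<Rightarrow> nat) \<Rightarrow> nat list" where
  "new_child a N = N a # a"

definition grow :: "nat list \<Rightarrow> (nat list \<Rightarrow> nat) \<Rightarrow> nat list \<Rightarrow> nat" where
  "grow a N = N(a := Suc (N a), new_child a N := 0)"

text \<open>
  Walks of length \<open>s\<close> from \<open>a\<close> back to the root of a tree explored on the way: steps to a new child
  have weight \<open>c\<close>, steps up have weight \<open>1\<close>, and steps down to a child visited before have weight \<open>x\<close>.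
\<close>

fun tree_walks :: "real \<Rightarrow> real \<Rightarrow> nat \<Rightarrow> nat list \<Rightarrow> (nat list \<Rightarrow> nat) \<Rightarrow> real" where
  "tree_walks c x 0 a N = of_bool (a = [])"
| "tree_walks c x (Suc s) a N =
     c * tree_walks c x s (new_child a N) (grow a N)
     + (if a = [] then 0 else tree_walks c x s (tl a) N)
     + x * (\<Sum>i<N a. tree_walks c x s (i # a) N)"

text \<open>A walk home from depth \<open>h\<close> with \<open>d\<close> steps down has length
  \<open>s = h + 2 * d\<close>. If \<open>r\<close> of these steps enter visited children, then
  \<open>sqrt c ^ h * c ^ (d - r) = sqrt c ^ s * (1 / c) ^ r\<close>.\<close>

lemma tree_walks_rescale:
  assumes "c > 0"
  shows "sqrt c ^ length a * tree_walks c 1 s a N = sqrt c ^ s * tree_walks 1 (1 / c) s a N"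
proof (induction s arbitrary: a N)
  case (Suc s)
  have r: "c = sqrt c * sqrt c" "sqrt c \<noteq> 0" using assms by auto
  let ?q = "sqrt c"
  have 1: "?q ^ length a * (c * tree_walks c 1 s (new_child a N) (grow a N)) =
      ?q ^ Suc s * tree_walks 1 (1 / c) s (new_child a N) (grow a N)"
  proof -
    have "?q ^ length a * (c * tree_walks c 1 s (new_child a N) (grow a N)) =
        ?q * (?q ^ length (new_child a N) * tree_walks c 1 s (new_child a N) (grow a N))"
      by (subst r(1)) (simp add: new_child_def)
    then show ?thesis by (simp only: Suc.IH) simp
  qed
  have 2: "?q ^ length a * tree_walks c 1 s (tl a) N = ?q ^ Suc s * tree_walks 1 (1 / c) s (tl a) N"
    if "a \<noteq> []"
    using Suc.IH[of "tl a" N] that by (cases a) (simp_all add: algebra_simps)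
  have 3: "?q ^ length a * tree_walks c 1 s (i # a) N =
      ?q ^ Suc s * ((1 / c) * tree_walks 1 (1 / c) s (i # a) N)" for i
  proof -
    have "?q * (?q ^ length a * tree_walks c 1 s (i # a) N) =
        ?q * (?q ^ Suc s * ((1 / c) * tree_walks 1 (1 / c) s (i # a) N))"
      using Suc.IH[of "i # a" N] r assms by (simp add: field_simps)
    then show ?thesis by (simp only: mult_left_cancel[OF r(2)])
  qed
  show ?case
    using 1 2 3 by (cases "a = []") (simp_all add: distrib_left sum_distrib_left)
qed auto

section \<open>Expansion of the tree walk weight to first order in \<open>1 / c\<close>\<close>

fun spine_children :: "nat list \<Rightarrow> (nat list \<Rightarrow> nat) \<Rightarrow> nat" where
  "spine_children [] N = N []"
| "spine_children (i # a) N = N (i # a) + spine_children a N"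

lemma spine_children_upd: "length a < length b \<Longrightarrow> spine_children a (N(b := m)) = spine_children a N"
  by (induction a) auto

text \<open>The old endpoint gains one child and the new vertex starts with none, so a step to a new
  child raises depth and spine count by one each.\<close>

lemma spine_children_grow:
  "spine_children (new_child a N) (grow a N) = Suc (spine_children a N)"
proof -
  have "spine_children a (N(a := Suc (N a))) = Suc (spine_children a N)"
    by (cases a) (auto simp: spine_children_upd)
  moreover have "spine_children a (grow a N) = spine_children a (N(a := Suc (N a)))"
    unfolding grow_def by (rule spine_children_upd) (simp add: new_child_def)
  moreover have "grow a N (new_child a N) = 0"
    by (simp add: grow_def)
  ultimately show ?thesis
    by (simp add: new_child_def)
qed

text \<open>
  The weight of the walks with exactly one step down to a visited child. Counted by generating functions
  (\<open>C\<close> for Dyck paths, variable \<open>z\<close>), such a step to any one of the children already present on the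
  current spine contributes \<open>z ^ (h + 2) * C ^ (h + 3)\<close> at depth \<open>h\<close>, whatever the level of the child;
  so only the total number \<open>d\<close> of these children matters.
\<close>

definition second_order :: "nat \<Rightarrow> nat \<Rightarrow> nat \<Rightarrow> real" where
  "second_order s h d = of_nat d * ballot s (int h + 2) + (of_nat h + 1) * cos_coeff s (int h + 4)"

text \<open>Here \<open>m\<close> is the number of visited children of the current vertex; at the
  root the spine has no other children, hence \<open>d = m\<close>. The last term spends the one
  allowed step into a visited child. After cancellation there remains
  \<open>ballot s (h + 3) = cos_coeff s (h + 3) - cos_coeff s (h + 5)\<close>.\<close>

lemma second_order_Suc:
  assumes "h = 0 \<Longrightarrow> d = m" "m \<le> d"
  shows "second_order (Suc s) h d = second_order s (Suc h) (Suc d)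
    + (if h = 0 then 0 else second_order s (h - 1) (d - m)) + real m * ballot s (int h + 1)"
proof (cases h)
  case 0
  then show ?thesis
    using assms(1) 
    by (simp add: second_order_def ballot_Suc cos_coeff_Suc ballot_def algebra_simps)
next
  case (Suc k)
  have "real (d - m) = real d - real m" using assms(2) by simp
  then show ?thesis
    using Suc by (simp add: second_order_def ballot_Suc cos_coeff_Suc ballot_def algebra_simps)
qed

text \<open>Steps to a new child and steps up have weight \<open>1\<close> and pass the error of the
  induction hypothesis on unchanged. A step to a visited child carries \<open>1 / c\<close>, so
  there the leading term \<open>ballot\<close> suffices.\<close>

lemma tree_walks_expansion:
  "(\<lambda>c. tree_walks 1 (1 / c) s a N - ballot s (length a)
      - 1 / c * second_order s (length a) (spine_children a N)) \<in> O[at_top](\<lambda>c. 1 / c\<^sup>2)"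
proof (induction s arbitrary: a N)
  case 0
  have "second_order 0 (length a) (spine_children a N) = 0"
    by (simp add: second_order_def ballot_def cos_coeff_0)
  moreover have "ballot 0 (length a) = of_bool (a = [])"
    by (simp add: ballot_def cos_coeff_0)
  ultimately show ?case by simp
next
  case (Suc s)
  let ?h = "length a" and ?d = "spine_children a N" and ?m = "N a"
  define R where "R a N c = tree_walks 1 (1 / c) s a N - ballot s (length a)
      - 1 / c * second_order s (length a) (spine_children a N)" for a N c
  have R: "R a N \<in> O[at_top](\<lambda>c. 1 / c\<^sup>2)" for a N
    using Suc.IH[of a N] unfolding R_def .
  \<comment> \<open>The prefactor pushes the first-order term of the child, with constant
    coefficient \<open>C\<close>, to order \<open>1 / c\<^sup>2\<close>.\<close>
  have child: "(\<lambda>c. 1 / c * (tree_walks 1 (1 / c) s b N - ballot s (length b))) \<in> O[at_top](\<lambda>c. 1 / c\<^sup>2)" for b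
  proof -
    define C where "C = second_order s (length b) (spine_children b N)"
    have eq: "(\<lambda>c. 1 / c * (tree_walks 1 (1 / c) s b N - ballot s (length b))) =
        (\<lambda>c. 1 / c * R b N c + C * (1 / c\<^sup>2))"
      by (auto simp: R_def C_def fun_eq_iff algebra_simps power2_eq_square)
    have "(\<lambda>c::real. 1 / c) \<in> O[at_top](\<lambda>c. 1)"
      by real_asymp
    from landau_o.big.mult[OF this R[of b N]]
    have "(\<lambda>c. 1 / c * R b N c) \<in> O[at_top](\<lambda>c. 1 / c\<^sup>2)" by simp
    moreover have "(\<lambda>c. C * (1 / c\<^sup>2)) \<in> O[at_top](\<lambda>c. 1 / c\<^sup>2)"
      by (intro bigoI[of _ "\<bar>C\<bar>"]) (auto simp: abs_mult)
    ultimately show ?thesis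
      unfolding eq by (rule sum_in_bigo(1))
  qed
  have children: "(\<lambda>c. \<Sum>i<?m. 1 / c * (tree_walks 1 (1 / c) s (i # a) N - ballot s (length (i # a))))
      \<in> O[at_top](\<lambda>c. 1 / c\<^sup>2)"
    by (intro big_sum_in_bigo child)
  have up: "(\<lambda>c. if a = [] then 0 else R (tl a) N c) \<in> O[at_top](\<lambda>c. 1 / c\<^sup>2)"
    using R by (cases "a = []") auto
  have so: "second_order (Suc s) ?h ?d = second_order s (Suc ?h) (Suc ?d)
    + (if a = [] then 0 else second_order s (?h - 1) (spine_children (tl a) N)) + real ?m * ballot s (int ?h + 1)"
  proof (cases a)
    case Nil
    then show ?thesis using second_order_Suc[of 0 ?d ?m s] by simp
  next
    case (Cons i b)
    then show ?thesis using second_order_Suc[of ?h ?d ?m s] by simp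
  qed
  have ba: "ballot (Suc s) ?h = ballot s (int ?h + 1) + (if a = [] then 0 else ballot s (int (?h - 1)))"
    by (cases a) (simp_all add: ballot_Suc ballot_minus_1)
  have "tree_walks 1 (1 / c) (Suc s) a N - ballot (Suc s) ?h - 1 / c * second_order (Suc s) ?h ?d =
      R (new_child a N) (grow a N) c + (if a = [] then 0 else R (tl a) N c) +
      (\<Sum>i<?m. 1 / c * (tree_walks 1 (1 / c) s (i # a) N - ballot s (length (i # a))))" for c
    unfolding so ba R_def spine_children_grow tree_walks.simps
    by (simp add: new_child_def algebra_simps sum_distrib_left sum_subtractf sum_divide_distrib add_divide_distrib)
  with sum_in_bigo(1)[OF sum_in_bigo(1)[OF R up] children]
  show ?case by simp
qed

text \<open>At the root of the unexplored tree depth and spine count are both \<open>0\<close>,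
  which leaves only \<open>cos_coeff k 4\<close> in \<open>second_order\<close>.\<close>

lemma root_tree_walks_expansion:
  "(\<lambda>c. tree_walks 1 (1 / c) k [] (\<lambda>_. 0) - (cos_coeff k 0 - cos_coeff k 2)
      - 1 / c * cos_coeff k 4) \<in> o[at_top](\<lambda>c. 1 / c)"
proof -
  have "(\<lambda>c::real. 1 / c\<^sup>2) \<in> o[at_top](\<lambda>c. 1 / c)" by real_asymp
  from landau_o.big_small_trans[OF tree_walks_expansion[of k "[]" "\<lambda>_. 0"] this]
  show ?thesis by (simp add: second_order_def ballot_def)
qed

subsection \<open>Walk weights on the complete graph\<close>

definition edge :: "nat \<Rightarrow> nat \<Rightarrow> nat \<times> nat" where
  "edge u v = (min u v, max u v)"

lemma edge_eq_iff: "edge u v = edge u' v' \<longleftrightarrow> (u = u' \<and> v = v') \<or> (u = v' \<and> v = u')"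
  by (auto simp: edge_def min_def max_def split: if_splits)

lemma edge_commute: "edge u v = edge v u"
  by (auto simp: edge_eq_iff)

text \<open>
  The sum of \<open>p\<close> to the number of edges outside \<open>E\<close>, over all walks of length \<open>s\<close> from \<open>u\<close> to \<open>r\<close>.
\<close>

fun walk_weight :: "nat \<Rightarrow> real \<Rightarrow> nat \<Rightarrow> nat \<Rightarrow> (nat \<times> nat) set \<Rightarrow> nat \<Rightarrow> real" where
  "walk_weight n p r 0 E u = of_bool (u = r)"
| "walk_weight n p r (Suc s) E u =
     (\<Sum>v\<in>{..<n} - {u}. (if edge u v \<in> E then 1 else p) * walk_weight n p r s (insert (edge u v) E) v)"

lemma walk_weight_nonneg: "0 \<le> p \<Longrightarrow> 0 \<le> walk_weight n p r s E u"
  by (induction s arbitrary: E u) (auto intro!: sum_nonneg)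

text \<open>A step uses one of at most \<open>card E\<close> known edges with weight
  \<open>1\<close>, or a new edge, and the new edges together weigh at most
  \<open>n * p \<le> c\<close>. Each step adds at most one edge to \<open>E\<close>.\<close>

lemma walk_weight_le:
  assumes "finite E" "0 \<le> p" "real n * p \<le> c"
  shows "walk_weight n p r s E u \<le> (real (card E) + real s + c) ^ s"
  using assms(1)
proof (induction s arbitrary: E u)
  case (Suc s)
  have c0: "0 \<le> c" using assms(2,3) by (meson mult_nonneg_nonneg of_nat_0_le_iff order_trans)
  \<comment> \<open>With \<open>Suc s\<close> in the base, \<open>M\<close> still bounds the
    remaining walk when \<open>E\<close> has gained an edge and the length has dropped by
    one.\<close>
  define M where "M = (real (card E) + real (Suc s) + c) ^ s"
  have M0: "0 \<le> M" using c0 by (simp add: M_def)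
  have le: "walk_weight n p r s (insert (edge u v) E) v \<le> M" for v
  proof -
    have "walk_weight n p r s (insert (edge u v) E) v
        \<le> (real (card (insert (edge u v) E)) + real s + c) ^ s"
      using Suc by simp
    also have "\<dots> \<le> M"
      unfolding M_def using c0 card_insert_le_m1[of "Suc (card E)" E "edge u v"]
      by (intro power_mono) auto
    finally show ?thesis .
  qed
  have "walk_weight n p r (Suc s) E u \<le> (\<Sum>v\<in>{..<n} - {u}. (of_bool (edge u v \<in> E) + p) * M)"
    unfolding walk_weight.simps
    using le assms(2) walk_weight_nonneg[OF assms(2)]
    by (intro sum_mono mult_mono) auto
  also have "\<dots> = (\<Sum>v\<in>{..<n} - {u}. of_bool (edge u v \<in> E) + p) * M"
    by (rule sum_distrib_right[symmetric])
  also have "\<dots> \<le> (real (card E) + c) * M"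
  proof (intro mult_right_mono M0)
    have "(\<Sum>v\<in>{..<n} - {u}. of_bool (edge u v \<in> E)) = real (card {v \<in> {..<n} - {u}. edge u v \<in> E})"
      by (simp add: sum.If_cases of_bool_def Int_def)
    \<comment> \<open>The edge and its endpoint \<open>u\<close> determine \<open>v\<close>.\<close>
    also have "card {v \<in> {..<n} - {u}. edge u v \<in> E} \<le> card E"
      by (rule card_inj_on_le[of "edge u"]) (auto simp: inj_on_def edge_eq_iff Suc)
    finally have 1: "(\<Sum>v\<in>{..<n} - {u}. of_bool (edge u v \<in> E)) \<le> real (card E)" by simp
    have "(\<Sum>v\<in>{..<n} - {u}. p) \<le> (\<Sum>v\<in>{..<n}. p)"
      using assms(2) by (intro sum_mono2) auto
    also have "\<dots> \<le> c" using assms(3) by simp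
    finally show "(\<Sum>v\<in>{..<n} - {u}. of_bool (edge u v \<in> E) + p) \<le> real (card E) + c"
      using 1 by (simp only: sum.distrib)
  qed
  also have "\<dots> \<le> (real (card E) + real (Suc s) + c) * M"
    by (intro mult_right_mono M0) simp
  finally show ?case by (simp add: M_def)
qed simp

section \<open>Plane trees embedded in the complete graph\<close>

fun is_address :: "(nat list \<Rightarrow> nat) \<Rightarrow> nat list \<Rightarrow> bool" where
  "is_address N [] = True"
| "is_address N (i # a) = (i < N a \<and> is_address N a)"

definition addresses :: "(nat list \<Rightarrow> nat) \<Rightarrow> nat list set" where
  "addresses N = Collect (is_address N)"

lemma Nil_in_addresses [simp]: "[] \<in> addresses N"
  by (simp add: addresses_def)

lemma Cons_in_addresses [simp]: "i # a \<in> addresses N \<longleftrightarrow> i < N a \<and> a \<in> addresses N"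
  by (simp add: addresses_def)

lemma new_child_notin_addresses: "new_child a N \<notin> addresses N"
  by (simp add: new_child_def)

text \<open>\<open>N\<close> is arbitrary off the tree; resetting it to \<open>0\<close> at the new
  vertex keeps descendants of that vertex from becoming addresses.\<close>

lemma addresses_grow:
  assumes "a \<in> addresses N"
  shows "addresses (grow a N) = insert (new_child a N) (addresses N)"
proof -
  have "b \<in> addresses (grow a N) \<longleftrightarrow> b = new_child a N \<or> b \<in> addresses N" for b
  proof (induction b)
    case (Cons i b)
    then show ?case
      using assms new_child_notin_addresses[of a N]
      by (auto simp: grow_def new_child_def split: if_splits)
  qed simp
  then show ?thesis by blast
qed

definition adjacent :: "nat list \<Rightarrow> nat list \<Rightarrow> bool" where
  "adjacent a b \<longleftrightarrow> (\<exists>i. b = i # a) \<or> (\<exists>i. a = i # b)"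

definition tree_edges :: "(nat list \<Rightarrow> nat) \<Rightarrow> (nat list \<Rightarrow> nat) \<Rightarrow> (nat \<times> nat) set" where
  "tree_edges \<phi> N = {edge (\<phi> b) (\<phi> (i # b)) | i b. i # b \<in> addresses N}"

definition embeds :: "nat \<Rightarrow> nat \<Rightarrow> (nat list \<Rightarrow> nat) \<Rightarrow> (nat list \<Rightarrow> nat) \<Rightarrow> bool" where
  "embeds n r \<phi> N \<longleftrightarrow> inj_on \<phi> (addresses N) \<and> \<phi> ` addresses N \<subseteq> {..<n} \<and> \<phi> [] = r"

text \<open>Injectivity lets edges be read back in the tree. Among steps between embedded vertices
  this separates those along a used edge from those that would close a cycle.\<close>

lemma edge_in_tree_edges_iff:
  assumes "inj_on \<phi> (addresses N)" "a \<in> addresses N" "b \<in> addresses N"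
  shows "edge (\<phi> a) (\<phi> b) \<in> tree_edges \<phi> N \<longleftrightarrow> adjacent a b"
proof
  assume "edge (\<phi> a) (\<phi> b) \<in> tree_edges \<phi> N"
  then obtain i d where id: "i # d \<in> addresses N" and "edge (\<phi> a) (\<phi> b) = edge (\<phi> d) (\<phi> (i # d))"
    by (auto simp: tree_edges_def)
  then consider "\<phi> a = \<phi> d" "\<phi> b = \<phi> (i # d)" | "\<phi> a = \<phi> (i # d)" "\<phi> b = \<phi> d"
    by (auto simp: edge_eq_iff)
  moreover have "d \<in> addresses N" using id by simp
  ultimately have "(a = d \<and> b = i # d) \<or> (a = i # d \<and> b = d)"
    using inj_onD[OF assms(1)] assms(2,3) id by cases blast+
  then show "adjacent a b" by (auto simp: adjacent_def)
next
  assume "adjacent a b"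
  then consider i where "b = i # a" | i where "a = i # b"
    by (auto simp: adjacent_def)
  then show "edge (\<phi> a) (\<phi> b) \<in> tree_edges \<phi> N"
  proof cases
    case 1
    then show ?thesis using assms(3) unfolding tree_edges_def by blast
  next
    case 2
    then have "edge (\<phi> b) (\<phi> a) \<in> tree_edges \<phi> N"
      using assms(2) unfolding tree_edges_def by blast
    then show ?thesis by (simp add: edge_commute)
  qed
qed

lemma edge_notin_tree_edges:
  assumes "v \<notin> \<phi> ` addresses N"
  shows "edge u v \<notin> tree_edges \<phi> N"
  using assms by (auto simp: tree_edges_def edge_eq_iff)

text \<open>Matches \<open>grow\<close> on the tree side with the \<open>insert\<close> in the
  recursion of \<open>walk_weight\<close>.\<close>

lemma tree_edges_grow:
  assumes "a \<in> addresses N"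
  shows "tree_edges (\<phi>(new_child a N := v)) (grow a N) = insert (edge (\<phi> a) v) (tree_edges \<phi> N)"
proof -
  define \<psi> where "\<psi> = \<phi>(new_child a N := v)"
  have new: "\<psi> (N a # a) = v"
    by (simp add: \<psi>_def new_child_def)
  have old: "\<psi> b = \<phi> b" if "b \<in> addresses N" for b
    using that new_child_notin_addresses[of a N] by (auto simp: \<psi>_def)
  have "x \<in> tree_edges \<psi> (grow a N) \<longleftrightarrow> x = edge (\<phi> a) v \<or> x \<in> tree_edges \<phi> N" for x
  proof -
    have "x \<in> tree_edges \<psi> (grow a N) \<longleftrightarrow>
        (\<exists>i b. x = edge (\<psi> b) (\<psi> (i # b)) \<and> (i # b = N a # a \<or> i # b \<in> addresses N))"
      unfolding tree_edges_def addresses_grow[OF assms] new_child_def by simp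
    also have "\<dots> \<longleftrightarrow> x = edge (\<psi> a) (\<psi> (N a # a)) \<or>
        (\<exists>i b. x = edge (\<psi> b) (\<psi> (i # b)) \<and> i # b \<in> addresses N)"
      by blast
    also have "(\<exists>i b. x = edge (\<psi> b) (\<psi> (i # b)) \<and> i # b \<in> addresses N) \<longleftrightarrow>
        (\<exists>i b. x = edge (\<phi> b) (\<phi> (i # b)) \<and> i # b \<in> addresses N)"
    proof (intro ex_cong1)
      fix i b
      show "(x = edge (\<psi> b) (\<psi> (i # b)) \<and> i # b \<in> addresses N) \<longleftrightarrow>
          (x = edge (\<phi> b) (\<phi> (i # b)) \<and> i # b \<in> addresses N)"
        by (cases "i # b \<in> addresses N") (auto simp: old)
    qed
    finally show ?thesis
      by (simp add: tree_edges_def new old[OF assms])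
  qed
  then show ?thesis by (auto simp: \<psi>_def)
qed

lemma embeds_grow:
  assumes "embeds n r \<phi> N" "a \<in> addresses N" "v < n" "v \<notin> \<phi> ` addresses N"
  shows "embeds n r (\<phi>(new_child a N := v)) (grow a N)"
proof -
  define \<psi> where "\<psi> = \<phi>(new_child a N := v)"
  have new: "\<psi> (new_child a N) = v" and root: "\<psi> [] = \<phi> []"
    by (simp_all add: \<psi>_def new_child_def)
  have old: "\<psi> b = \<phi> b" if "b \<in> addresses N" for b
    using that new_child_notin_addresses[of a N] by (auto simp: \<psi>_def)
  have image: "\<psi> ` addresses N = \<phi> ` addresses N"
    by (intro image_cong refl old)
  have "inj_on \<psi> (addresses N)"
    using assms(1) inj_on_cong[of "addresses N" \<psi> \<phi>] old by (simp add: embeds_def)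
  moreover have "\<psi> (new_child a N) \<notin> \<psi> ` (addresses N - {new_child a N})"
    unfolding new using assms(4) image by blast
  ultimately have "inj_on \<psi> (insert (new_child a N) (addresses N))"
    by (simp only: inj_on_insert simp_thms)
  moreover have "\<psi> ` insert (new_child a N) (addresses N) \<subseteq> {..<n}"
    using assms(1,3) by (simp add: image new embeds_def)
  ultimately have "embeds n r \<psi> (grow a N)"
    using assms(1) by (simp only: embeds_def addresses_grow[OF assms(2)] root simp_thms)
  then show ?thesis by (simp only: \<psi>_def)
qed

text \<open>The neighbours of a tree vertex are its parent and its visited children, which gives the
  last two terms of the recursion of \<open>tree_walks\<close> at \<open>x = 1\<close>.\<close>

lemma sum_adjacent_addresses:
  fixes f :: "nat list \<Rightarrow> real"
  assumes "finite (addresses N)" "a \<in> addresses N"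
  shows "(\<Sum>b\<in>addresses N - {a}. if adjacent a b then f b else 0) =
    (if a = [] then 0 else f (tl a)) + (\<Sum>i<N a. f (i # a))"
proof -
  let ?P = "if a = [] then {} else {tl a}" and ?C = "(\<lambda>i. i # a) ` {..<N a}"
  have eq: "{b \<in> addresses N - {a}. adjacent a b} = ?P \<union> ?C"
    using assms(2) by (cases a) (auto simp: adjacent_def)
  have disj: "?P \<inter> ?C = {}"
    by (cases a) auto
  have "(\<Sum>b\<in>addresses N - {a}. if adjacent a b then f b else 0) = sum f {b \<in> addresses N - {a}. adjacent a b}"
    using assms(1) by (intro sum.mono_neutral_cong_right) auto
  also have "\<dots> = sum f ?P + sum f ?C"
    unfolding eq using disj by (intro sum.union_disjoint) auto
  also have "sum f ?C = (\<Sum>i<N a. f (i # a))"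
    by (subst sum.reindex) (auto simp: inj_on_def)
  finally show ?thesis by auto
qed

text \<open>
  Steps to a vertex outside the tree have total weight close to \<open>c\<close>; steps closing a cycle have weight
  \<open>O(1 / n)\<close>. The constant \<open>K\<close> must not depend on \<open>\<phi>\<close>, since \<open>\<phi>\<close> changes with the new vertex.
\<close>

lemma walk_weight_approx:
  assumes c: "c \<ge> 0" and "finite (addresses N)" "a \<in> addresses N"
  shows "\<exists>K\<ge>0. \<forall>n r \<phi>. n > 0 \<longrightarrow> embeds n r \<phi> N \<longrightarrow>
    \<bar>walk_weight n (c / real n) r s (tree_edges \<phi> N) (\<phi> a) - tree_walks c 1 s a N\<bar> \<le> K / real n"
  using assms(2,3)
proof (induction s arbitrary: a N)
  case 0
  have "walk_weight n (c / real n) r 0 (tree_edges \<phi> N) (\<phi> a) = tree_walks c 1 0 a N"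
    if "embeds n r \<phi> N" for n r \<phi>
    using that 0 inj_on_eq_iff[of \<phi> "addresses N" a "[]"] by (auto simp: embeds_def)
  then show ?case by (intro exI[of _ 0]) auto
next
  case (Suc s)
  note fin = \<open>finite (addresses N)\<close> and a = \<open>a \<in> addresses N\<close>
  define t where "t b = tree_walks c 1 s b N" for b
  define t' where "t' = tree_walks c 1 s (new_child a N) (grow a N)"
  define m where "m = real (card (addresses N))"
  have "finite (addresses (grow a N))" "new_child a N \<in> addresses (grow a N)"
    using fin a by (auto simp: addresses_grow)
  from Suc.IH[OF this] obtain K1 where K1: "K1 \<ge> 0"
    and K1': "\<And>n r \<phi>. n > 0 \<Longrightarrow> embeds n r \<phi> (grow a N) \<Longrightarrow>
      \<bar>walk_weight n (c / real n) r s (tree_edges \<phi> (grow a N)) (\<phi> (new_child a N)) - t'\<bar> \<le> K1 / real n"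
    unfolding t'_def by blast
  have "\<forall>b\<in>addresses N. \<exists>K\<ge>0. \<forall>n r \<phi>. n > 0 \<longrightarrow> embeds n r \<phi> N \<longrightarrow>
    \<bar>walk_weight n (c / real n) r s (tree_edges \<phi> N) (\<phi> b) - t b\<bar> \<le> K / real n"
    using Suc.IH[OF fin] unfolding t_def by blast
  from bchoice[OF this] obtain K2 where K2: "\<And>b. b \<in> addresses N \<Longrightarrow> K2 b \<ge> 0"
    and K2': "\<And>b n r \<phi>. b \<in> addresses N \<Longrightarrow> n > 0 \<Longrightarrow> embeds n r \<phi> N \<Longrightarrow>
      \<bar>walk_weight n (c / real n) r s (tree_edges \<phi> N) (\<phi> b) - t b\<bar> \<le> K2 b / real n"
    by blast
  \<comment> \<open>The bound of \<open>walk_weight_le\<close> for a tree with at most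
    \<open>m\<close> edges together with one edge closing a cycle.\<close>
  define B where "B = (m + 1 + real s + c) ^ s"
  have B: "B \<ge> 0" using c by (simp add: B_def m_def)
  \<comment> \<open>Three sources of error: steps to vertices already in the tree, the approximation
    after a step to a new vertex, and the fact that only \<open>n - m\<close> of the
    \<open>n\<close> vertices are new.\<close>
  define K where "K = (\<Sum>b\<in>addresses N. K2 b + c * B) + (c * K1 + m * c * \<bar>t'\<bar>)"
  have K: "K \<ge> 0"
    unfolding K_def m_def using c B K1 K2 by (intro add_nonneg_nonneg sum_nonneg) auto
  have "\<bar>walk_weight n (c / real n) r (Suc s) (tree_edges \<phi> N) (\<phi> a) - tree_walks c 1 (Suc s) a N\<bar> \<le> K / real n"
    if n: "n > 0" and emb: "embeds n r \<phi> N" for n r \<phi>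
  proof -
    let ?p = "c / real n" and ?E = "tree_edges \<phi> N" and ?V = "\<phi> ` addresses N"
    have p: "?p \<ge> 0" using c by simp
    have inj: "inj_on \<phi> (addresses N)" and V: "?V \<subseteq> {..<n}"
      using emb by (auto simp: embeds_def)
    have cV: "card ?V = card (addresses N)" using inj by (rule card_image)
    \<comment> \<open>Every tree edge joins the image of some address to that of its parent, so
      there are at most as many edges as addresses.\<close>
    have E: "finite ?E \<and> card ?E \<le> card (addresses N)"
    proof -
      have "?E \<subseteq> (\<lambda>b. edge (\<phi> (tl b)) (\<phi> b)) ` addresses N"
      proof
        fix x assume "x \<in> ?E"
        then obtain i b where "x = edge (\<phi> b) (\<phi> (i # b))" "i # b \<in> addresses N"
          unfolding tree_edges_def by blast
        then show "x \<in> (\<lambda>b. edge (\<phi> (tl b)) (\<phi> b)) ` addresses N"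
          by (intro image_eqI[of _ _ "i # b"]) auto
      qed
      then show ?thesis using fin by (meson finite_imageI finite_subset surj_card_le)
    qed
    define w where "w v = (if edge (\<phi> a) v \<in> ?E then 1 else ?p) *
        walk_weight n ?p r s (insert (edge (\<phi> a) v) ?E) v" for v
    \<comment> \<open>A step to an adjacent address repeats a used edge and leaves the tree
      unchanged. Any other step inside the tree closes a cycle and costs \<open>c / n\<close> times
      a bounded weight.\<close>
    have old: "\<bar>w (\<phi> b) - (if adjacent a b then t b else 0)\<bar> \<le> (K2 b + c * B) / real n"
      if b: "b \<in> addresses N" for b
    proof (cases "adjacent a b")
      case True
      then have "edge (\<phi> a) (\<phi> b) \<in> ?E" using edge_in_tree_edges_iff[OF inj a b] by simp
      then have "w (\<phi> b) = walk_weight n ?p r s ?E (\<phi> b)"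
        by (simp add: w_def insert_absorb)
      then have "\<bar>w (\<phi> b) - t b\<bar> \<le> K2 b / real n" using K2'[OF b n emb] by simp
      also have "\<dots> \<le> (K2 b + c * B) / real n"
        using c B by (intro divide_right_mono) auto
      finally show ?thesis using True by simp
    next
      case False
      then have "edge (\<phi> a) (\<phi> b) \<notin> ?E" using edge_in_tree_edges_iff[OF inj a b] by simp
      then have "w (\<phi> b) = ?p * walk_weight n ?p r s (insert (edge (\<phi> a) (\<phi> b)) ?E) (\<phi> b)"
        by (simp add: w_def)
      moreover have "walk_weight n ?p r s (insert (edge (\<phi> a) (\<phi> b)) ?E) (\<phi> b) \<le> B"
      proof -
        have "walk_weight n ?p r s (insert (edge (\<phi> a) (\<phi> b)) ?E) (\<phi> b)
          \<le> (real (card (insert (edge (\<phi> a) (\<phi> b)) ?E)) + real s + c) ^ s"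
          using E p n by (intro walk_weight_le) auto
        also have "\<dots> \<le> B"
          unfolding B_def m_def using c E by (intro power_mono) (auto simp: card_insert_if)
        finally show ?thesis .
      qed
      moreover have "0 \<le> walk_weight n ?p r s (insert (edge (\<phi> a) (\<phi> b)) ?E) (\<phi> b)"
        by (rule walk_weight_nonneg[OF p])
      ultimately have "\<bar>w (\<phi> b)\<bar> \<le> ?p * B"
        using p by (simp only: abs_mult abs_of_nonneg mult_left_mono)
      also have "\<dots> \<le> (K2 b + c * B) / real n"
        using K2[OF b] by (simp add: divide_right_mono)
      finally show ?thesis using False by simp
    qed
    \<comment> \<open>An unvisited \<open>v\<close> becomes the image of the new child. The bound
      \<open>K1\<close> holds for every embedding, hence uniformly in \<open>v\<close>.\<close>
    have new: "\<bar>w v - ?p * t'\<bar> \<le> ?p * (K1 / real n)" if v: "v \<in> {..<n} - ?V" for v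
    proof -
      let ?\<phi> = "\<phi>(new_child a N := v)"
      have "w v = ?p * walk_weight n ?p r s (tree_edges ?\<phi> (grow a N)) (?\<phi> (new_child a N))"
        using v edge_notin_tree_edges[of v \<phi> N] by (simp add: w_def tree_edges_grow[OF a])
      moreover have "\<bar>walk_weight n ?p r s (tree_edges ?\<phi> (grow a N)) (?\<phi> (new_child a N)) - t'\<bar> \<le> K1 / real n"
        using v by (intro K1' n embeds_grow emb a) auto
      ultimately show ?thesis
        using p by (simp only: right_diff_distrib[symmetric] abs_mult abs_of_nonneg mult_left_mono)
    qed
    have "walk_weight n ?p r (Suc s) ?E (\<phi> a) = (\<Sum>v\<in>{..<n} - {\<phi> a}. w v)"
      by (simp add: w_def)
    also have "{..<n} - {\<phi> a} = (?V - {\<phi> a}) \<union> ({..<n} - ?V)"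
      using V a by auto
    also have "(\<Sum>v\<in>(?V - {\<phi> a}) \<union> ({..<n} - ?V). w v) = (\<Sum>v\<in>?V - {\<phi> a}. w v) + (\<Sum>v\<in>{..<n} - ?V. w v)"
      using fin by (intro sum.union_disjoint) auto
    also have "?V - {\<phi> a} = \<phi> ` (addresses N - {a})"
      using inj a by (auto dest: inj_onD)
    also have "(\<Sum>v\<in>\<phi> ` (addresses N - {a}). w v) = (\<Sum>b\<in>addresses N - {a}. w (\<phi> b))"
      by (subst sum.reindex) (use inj in \<open>auto intro: inj_on_subset\<close>)
    finally have W: "walk_weight n ?p r (Suc s) ?E (\<phi> a) =
        (\<Sum>b\<in>addresses N - {a}. w (\<phi> b)) + (\<Sum>v\<in>{..<n} - ?V. w v)" .
    have T: "tree_walks c 1 (Suc s) a N =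
        (\<Sum>b\<in>addresses N - {a}. if adjacent a b then t b else 0) + c * t'"
      using sum_adjacent_addresses[OF fin a, of t] by (simp add: t_def t'_def)
    have "\<bar>(\<Sum>b\<in>addresses N - {a}. w (\<phi> b)) - (\<Sum>b\<in>addresses N - {a}. if adjacent a b then t b else 0)\<bar>
        \<le> (\<Sum>b\<in>addresses N - {a}. (K2 b + c * B) / real n)"
      unfolding sum_subtractf[symmetric] using old by (intro order_trans[OF sum_abs] sum_mono) auto
    also have "\<dots> \<le> (\<Sum>b\<in>addresses N. (K2 b + c * B) / real n)"
      using fin K2 c B by (intro sum_mono2) auto
    also have "\<dots> = (\<Sum>b\<in>addresses N. K2 b + c * B) / real n"
      by (rule sum_divide_distrib[symmetric])
    finally have D1: "\<bar>(\<Sum>b\<in>addresses N - {a}. w (\<phi> b)) - (\<Sum>b\<in>addresses N - {a}. if adjacent a b then t b else 0)\<bar>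
        \<le> (\<Sum>b\<in>addresses N. K2 b + c * B) / real n" .
    have "\<bar>(\<Sum>v\<in>{..<n} - ?V. w v) - (\<Sum>v\<in>{..<n} - ?V. ?p * t')\<bar> \<le> (\<Sum>v\<in>{..<n} - ?V. ?p * (K1 / real n))"
      unfolding sum_subtractf[symmetric] using new by (intro order_trans[OF sum_abs] sum_mono) auto
    also have "\<dots> \<le> (\<Sum>v\<in>{..<n}. ?p * (K1 / real n))"
    proof (intro sum_mono2)
      show "0 \<le> ?p * (K1 / real n)" using p K1 by (intro mult_nonneg_nonneg) auto
    qed auto
    also have "\<dots> = c * K1 / real n" using n by simp
    finally have D2: "\<bar>(\<Sum>v\<in>{..<n} - ?V. w v) - (\<Sum>v\<in>{..<n} - ?V. ?p * t')\<bar> \<le> c * K1 / real n" .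
    have cle: "card (addresses N) \<le> n"
      using card_mono[OF _ V] cV by simp
    have "card ({..<n} - ?V) = n - card (addresses N)"
      using V fin cV by (simp add: card_Diff_subset)
    then have "(\<Sum>v\<in>{..<n} - ?V. ?p * t') = (real n - m) * (?p * t')"
      using cle by (simp add: m_def of_nat_diff)
    also have "\<dots> = c * t' - m * c * t' / real n"
      using n by (simp add: field_simps)
    finally have D3: "\<bar>(\<Sum>v\<in>{..<n} - ?V. ?p * t') - c * t'\<bar> = m * c * \<bar>t'\<bar> / real n"
      using c by (simp add: abs_mult m_def)
    have "\<bar>(x + y) - (x' + z)\<bar> \<le> d1 + (d2 + d3)"
      if "\<bar>x - x'\<bar> \<le> d1" "\<bar>y - y'\<bar> \<le> d2" "\<bar>y' - z\<bar> = d3" for x x' y y' z d1 d2 d3 :: real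
      using that by linarith
    from this[OF D1 D2 D3] show ?thesis
      unfolding W T K_def add_divide_distrib .
  qed
  with K show ?case by blast
qed

text \<open>The walk starts on the one-vertex tree, which embeds with its root at any
  \<open>r < n\<close>. The error \<open>K / n\<close> does not depend on \<open>r\<close>, so it
  survives averaging.\<close>

lemma tendsto_average_walk_weight:
  assumes "c \<ge> 0"
  shows "(\<lambda>n. (\<Sum>r<n. walk_weight n (c / real n) r s {} r) / real n) \<longlonglongrightarrow> tree_walks c 1 s [] (\<lambda>_. 0)"
proof -
  let ?N = "\<lambda>_::nat list. 0::nat" and ?t = "tree_walks c 1 s [] (\<lambda>_. 0)"
  have addr: "addresses ?N = {[]}"
  proof -
    have "b \<in> addresses ?N \<longleftrightarrow> b = []" for b by (cases b) auto
    then show ?thesis by auto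
  qed
  obtain K where "K \<ge> 0" and K: "\<And>n r \<phi>. n > 0 \<Longrightarrow> embeds n r \<phi> ?N \<Longrightarrow>
    \<bar>walk_weight n (c / real n) r s (tree_edges \<phi> ?N) (\<phi> []) - ?t\<bar> \<le> K / real n"
    using walk_weight_approx[OF assms, of ?N "[]" s] addr by auto
  have K': "\<bar>walk_weight n (c / real n) r s {} r - ?t\<bar> \<le> K / real n" if "r < n" for n r
    using K[of n r "\<lambda>_. r"] that by (simp add: embeds_def addr tree_edges_def)
  have bound: "\<bar>(\<Sum>r<n. walk_weight n (c / real n) r s {} r) / real n - ?t\<bar> \<le> K / real n" if n: "n > 0" for n
  proof -
    have "(\<Sum>r<n. walk_weight n (c / real n) r s {} r) / real n - ?t =
        (\<Sum>r<n. walk_weight n (c / real n) r s {} r - ?t) / real n"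
      using n by (simp add: sum_subtractf field_simps)
    also have "\<bar>\<dots>\<bar> \<le> (\<Sum>r<n. K / real n) / real n"
      unfolding abs_divide using K'
      by (intro frac_le order_trans[OF sum_abs] sum_mono) (use n \<open>K \<ge> 0\<close> in \<open>auto intro!: sum_nonneg\<close>)
    also have "\<dots> = K / real n" using n by simp
    finally show ?thesis .
  qed
  have "(\<lambda>n. K / real n) \<longlonglongrightarrow> 0"
    by real_asymp
  then have "(\<lambda>n. (\<Sum>r<n. walk_weight n (c / real n) r s {} r) / real n - ?t) \<longlonglongrightarrow> 0"
    by (rule Lim_null_comparison[rotated])
      (use bound in \<open>auto intro: eventually_mono[OF eventually_gt_at_top[of 0]]\<close>)
  then show ?thesis by (simp add: LIM_zero_iff)
qed

subsection \<open>Power sums of the eigenvalues of a symmetric matrix\<close>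

lemma sum_diagonal_mult_commute:
  fixes A B :: "'a :: comm_semiring_1 mat"
  assumes "A \<in> carrier_mat n n" "B \<in> carrier_mat n n"
  shows "(\<Sum>i<n. (A * B) $$ (i, i)) = (\<Sum>i<n. (B * A) $$ (i, i))"
proof -
  have "(\<Sum>i<n. (A * B) $$ (i, i)) = (\<Sum>i<n. \<Sum>j<n. A $$ (i, j) * B $$ (j, i))"
    using assms by (intro sum.cong) (auto simp: scalar_prod_def atLeast0LessThan)
  also have "\<dots> = (\<Sum>j<n. \<Sum>i<n. B $$ (j, i) * A $$ (i, j))"
    by (subst sum.swap) (simp add: mult.commute)
  also have "\<dots> = (\<Sum>i<n. (B * A) $$ (i, i))"
    using assms by (intro sum.cong) (auto simp: scalar_prod_def atLeast0LessThan)
  finally show ?thesis .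
qed

text \<open>Cyclicity of the trace turns \<open>P * (B * Q)\<close> into \<open>B * Q * P\<close>,
  and \<open>Q * P\<close> is the identity.\<close>

lemma sum_diagonal_similar:
  fixes A B :: "'a :: comm_ring_1 mat"
  assumes "A \<in> carrier_mat n n" "similar_mat A B"
  shows "(\<Sum>i<n. A $$ (i, i)) = (\<Sum>i<n. B $$ (i, i))"
proof -
  from assms(2) obtain P Q where "similar_mat_wit A B P Q"
    by (auto simp: similar_mat_def)
  note D = similar_mat_witD2[OF assms(1) this]
  have "(\<Sum>i<n. A $$ (i, i)) = (\<Sum>i<n. (P * (B * Q)) $$ (i, i))"
    using D by (simp add: assoc_mult_mat[of P n n B n Q n])
  also have "\<dots> = (\<Sum>i<n. (B * Q * P) $$ (i, i))"
    by (rule sum_diagonal_mult_commute) (use D in auto)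
  also have "B * Q * P = B"
    using D by (simp add: assoc_mult_mat[of B n n Q n P n])
  finally show ?thesis .
qed

text \<open>In an entry on or below the diagonal of a product of two upper triangular matrices, the
  only term that can be nonzero is the one with all indices equal.\<close>

lemma upper_triangular_pow_mat:
  fixes B :: "'a :: comm_semiring_1 mat"
  assumes B: "B \<in> carrier_mat n n" "upper_triangular B"
  shows "upper_triangular (B ^\<^sub>m k) \<and> (\<forall>i<n. (B ^\<^sub>m k) $$ (i, i) = (B $$ (i, i)) ^ k)"
proof (induction k)
  case 0
  then show ?case using B by (auto simp: upper_triangular_def)
next
  case (Suc k)
  have entry: "(B ^\<^sub>m Suc k) $$ (i, j) = (\<Sum>l<n. (B ^\<^sub>m k) $$ (i, l) * B $$ (l, j))"
    if "i < n" "j < n" for i j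
    using that B by (simp add: scalar_prod_def atLeast0LessThan)
  have zero: "(B ^\<^sub>m k) $$ (i, l) * B $$ (l, j) = 0"
    if "i < n" "l < n" "j \<le> i" "l \<noteq> i \<or> j \<noteq> i" for i j l
  proof (cases "l < i")
    case True
    then show ?thesis using Suc that B by (simp add: upper_triangular_def)
  next
    case False
    then have "j < l" using that by auto
    then show ?thesis using B that by (simp add: upper_triangular_def)
  qed
  have "(B ^\<^sub>m Suc k) $$ (i, j) = 0" if "i < n" "j < i" for i j
    using that zero[of i _ j] by (subst entry) (auto intro!: sum.neutral)
  moreover have "(B ^\<^sub>m Suc k) $$ (i, i) = (B $$ (i, i)) ^ Suc k" if "i < n" for i
  proof -
    have "(B ^\<^sub>m Suc k) $$ (i, i) = (\<Sum>l\<in>{i}. (B ^\<^sub>m k) $$ (i, l) * B $$ (l, i))"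
      unfolding entry[OF that that] using that zero[of i _ i]
      by (intro sum.mono_neutral_right) auto
    then show ?thesis using Suc that by (simp add: mult.commute)
  qed
  ultimately show ?case using B by (auto simp: upper_triangular_def)
qed

text \<open>Schur triangularisation puts the eigenvalues on the diagonal of a matrix similar to
  \<open>A\<close>; taking powers preserves similarity and raises the diagonal entries to the power
  \<open>k\<close>.\<close>

lemma power_sum_proots_char_poly:
  fixes A :: "real mat"
  assumes A: "A \<in> carrier_mat n n" and split: "char_poly A = (\<Prod>a\<leftarrow>es. [:- a, 1:])"
  shows "(\<Sum>a\<in>#proots (char_poly A). a ^ k) = (\<Sum>i<n. (A ^\<^sub>m k) $$ (i, i))"
proof -
  \<comment> \<open>The linear factors are recovered from the polynomial as a multiset, so two
    factorisations of \<open>char_poly A\<close> have the same roots with multiplicity.\<close>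
  have mset: "proots (\<Prod>a\<leftarrow>xs. [:- a, 1:]) = mset xs" for xs :: "real list"
  proof (induction xs)
    case (Cons x xs)
    have "(\<Prod>a\<leftarrow>xs. [:- a, 1:]) \<noteq> (0 :: real poly)"
      by (auto simp: prod_list_zero_iff)
    then have "proots ([:- x, 1:] * (\<Prod>a\<leftarrow>xs. [:- a, 1:])) = proots [:- x, 1:] + proots (\<Prod>a\<leftarrow>xs. [:- a, 1:])"
      by (intro proots_mult) auto
    then show ?case using Cons by (simp del: mult_pCons_left)
  qed simp
  define B where "B = schur_upper_triangular A es"
  note schur = schur_upper_triangular[OF A split, folded B_def]
  have "(\<Prod>a\<leftarrow>es. [:- a, 1:]) = (\<Prod>a\<leftarrow>diag_mat B. [:- a, 1:])"
    using char_poly_similar[OF schur(3)] char_poly_upper_triangular[OF schur(1,2)] split by simp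
  then have "mset es = mset (diag_mat B)" by (metis mset)
  then have "proots (char_poly A) = mset (diag_mat B)" by (simp add: split mset)
  then have "(\<Sum>a\<in>#proots (char_poly A). a ^ k) = (\<Sum>a\<leftarrow>diag_mat B. a ^ k)"
    by (simp flip: sum_mset_sum_list)
  also have "\<dots> = (\<Sum>i<n. (B $$ (i, i)) ^ k)"
    using schur(1) by (simp add: diag_mat_def o_def sum_list_distinct_conv_sum_set atLeast0LessThan)
  also have "\<dots> = (\<Sum>i<n. (B ^\<^sub>m k) $$ (i, i))"
    using upper_triangular_pow_mat[OF schur(1,2)] by (intro sum.cong) auto
  also have "\<dots> = (\<Sum>i<n. (A ^\<^sub>m k) $$ (i, i))"
  proof -
    obtain P Q where "similar_mat_wit A B P Q" using schur(3) by (auto simp: similar_mat_def)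
    then have "similar_mat (A ^\<^sub>m k) (B ^\<^sub>m k)"
      unfolding similar_mat_def using similar_mat_wit_pow by blast
    then show ?thesis using A by (intro sum_diagonal_similar[symmetric]) auto
  qed
  finally show ?thesis .
qed

section \<open>Real spectrum of symmetric matrices\<close>

lemma eigenvalue_symmetric_real:
  fixes A :: "real mat"
  assumes A: "A \<in> carrier_mat n n"
    and sym: "\<And>i j. i < n \<Longrightarrow> j < n \<Longrightarrow> A $$ (i, j) = A $$ (j, i)"
    and ev: "eigenvalue (map_mat complex_of_real A) e"
  shows "e \<in> \<real>"
proof -
  let ?A = "map_mat complex_of_real A"
  from ev obtain v where v: "v \<in> carrier_vec n" "v \<noteq> 0\<^sub>v n" "?A *\<^sub>v v = e \<cdot>\<^sub>v v"
    using A by (auto simp: eigenvalue_def eigenvector_def)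
  have row: "(\<Sum>j<n. of_real (A $$ (i, j)) * v $ j) = e * v $ i" if "i < n" for i
  proof -
    have "(?A *\<^sub>v v) $ i = (e \<cdot>\<^sub>v v) $ i" using v by simp
    then show ?thesis using that A v(1) by (simp add: scalar_prod_def atLeast0LessThan mult_mat_vec_def)
  qed
  \<comment> \<open>\<open>S\<close> is the sesquilinear form of \<open>A\<close> at
    \<open>v\<close> and \<open>T\<close> is the squared norm of \<open>v\<close>. The eigenvalue
    equation gives \<open>S = e * T\<close>, and symmetry makes \<open>S\<close> its own
    conjugate.\<close>
  define S where "S = (\<Sum>i<n. \<Sum>j<n. cnj (v $ i) * (of_real (A $$ (i, j)) * v $ j))"
  define T where "T = (\<Sum>i<n. (cmod (v $ i))\<^sup>2)"
  have "S = (\<Sum>i<n. cnj (v $ i) * (e * v $ i))"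
    unfolding S_def by (intro sum.cong) (simp_all add: row flip: sum_distrib_left)
  also have "\<dots> = e * of_real T"
    unfolding T_def of_real_sum sum_distrib_left
    by (intro sum.cong) (simp_all add: complex_norm_square mult_ac del: of_real_power)
  finally have S: "S = e * of_real T" .
  have "cnj S = (\<Sum>i<n. \<Sum>j<n. v $ i * (of_real (A $$ (i, j)) * cnj (v $ j)))"
    by (simp add: S_def)
  also have "\<dots> = (\<Sum>j<n. \<Sum>i<n. v $ i * (of_real (A $$ (i, j)) * cnj (v $ j)))"
    by (rule sum.swap)
  also have "\<dots> = S"
    unfolding S_def using sym by (intro sum.cong) (auto simp: mult_ac)
  finally have "cnj e * of_real T = e * of_real T"
    by (simp add: S)
  moreover have "T \<noteq> 0"
  proof
    assume "T = 0"
    then have "\<forall>i<n. v $ i = 0" by (simp add: T_def sum_nonneg_eq_0_iff)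
    then have "v = 0\<^sub>v n" using v by auto
    with v show False by simp
  qed
  ultimately show ?thesis by (simp add: Reals_cnj_iff)
qed

text \<open>The polynomial splits over the complex numbers, all its roots are real, and the
  factorisation descends because the embedding of the reals is injective on coefficients.\<close>

lemma char_poly_symmetric_splits:
  fixes A :: "real mat"
  assumes A: "A \<in> carrier_mat n n"
    and sym: "\<And>i j. i < n \<Longrightarrow> j < n \<Longrightarrow> A $$ (i, j) = A $$ (j, i)"
  obtains es where "char_poly A = (\<Prod>a\<leftarrow>es. [:- a, 1:])" "length es = n"
proof -
  let ?A = "map_mat complex_of_real A"
  have cA: "?A \<in> carrier_mat n n" using A by simp
  from char_poly_factorized[OF cA] obtain zs
    where zs: "char_poly ?A = (\<Prod>a\<leftarrow>zs. [:- a, 1:])" "length zs = n" by blast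
  have "z \<in> \<real>" if "z \<in> set zs" for z
  proof (rule eigenvalue_symmetric_real[OF A sym])
    have "poly (char_poly ?A) z = 0"
      using that unfolding zs(1) by (induction zs) auto
    then show "eigenvalue ?A z" using eigenvalue_root_char_poly[OF cA] by simp
  qed
  then have zs': "zs = map complex_of_real (map Re zs)"
    by (induction zs) auto
  define es where "es = map Re zs"
  have "map_poly complex_of_real (char_poly A) = char_poly ?A"
    by (rule of_real_hom.char_poly_hom[OF A, symmetric])
  also have "\<dots> = (\<Prod>a\<leftarrow>map complex_of_real es. [:- a, 1:])"
    using zs(1) zs' by (simp add: es_def)
  also have "\<dots> = map_poly complex_of_real (\<Prod>a\<leftarrow>es. [:- a, 1:])"
  proof -
    interpret of_real_poly: map_poly_comm_ring_hom complex_of_real ..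
    show ?thesis by (induction es) (simp_all add: of_real_poly.hom_mult del: mult_pCons_left)
  qed
  finally have "char_poly A = (\<Prod>a\<leftarrow>es. [:- a, 1:])"
    by (simp add: poly_eq_iff coeff_map_poly)
  moreover have "length es = n" using zs(2) by (simp add: es_def)
  ultimately show thesis by (rule that)
qed

lemma expectation_spectral_pmf:
  assumes A: "A \<in> carrier_mat n n" and n: "n > 0"
    and sym: "\<And>i j. i < n \<Longrightarrow> j < n \<Longrightarrow> A $$ (i, j) = A $$ (j, i)"
  shows "finite (set_pmf (spectral_pmf A))"
    and "measure_pmf.expectation (spectral_pmf A) (\<lambda>x. x ^ k) = (\<Sum>i<n. (A ^\<^sub>m k) $$ (i, i)) / real n"
proof -
  obtain es where es: "char_poly A = (\<Prod>a\<leftarrow>es. [:- a, 1:])" "length es = n"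
    using char_poly_symmetric_splits[OF A sym] by blast
  define R where "R = proots (char_poly A)"
  \<comment> \<open>The power sum with exponent \<open>0\<close> counts the eigenvalues.\<close>
  have "real (size R) = (\<Sum>a\<in>#R. a ^ 0)" by simp
  also have "\<dots> = (\<Sum>i<n. (A ^\<^sub>m 0) $$ (i, i))"
    unfolding R_def by (rule power_sum_proots_char_poly[OF A es(1)])
  also have "\<dots> = real n" using A by simp
  finally have size: "size R = n" by simp
  with n have R: "R \<noteq> {#}" by auto
  show "finite (set_pmf (spectral_pmf A))"
    unfolding spectral_pmf_def R_def[symmetric] using R by simp
  have "measure_pmf.expectation (spectral_pmf A) (\<lambda>x. x ^ k) =
      (\<Sum>a\<in>set_mset R. pmf (pmf_of_multiset R) a *\<^sub>R a ^ k)"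
    unfolding spectral_pmf_def R_def[symmetric] using R by (intro integral_measure_pmf) auto
  also have "\<dots> = (\<Sum>a\<in>set_mset R. real (count R a) * a ^ k) / real n"
    using R by (simp add: size sum_divide_distrib)
  also have "(\<Sum>a\<in>set_mset R. real (count R a) * a ^ k) = (\<Sum>a\<in>#R. a ^ k)"
  proof (induction R)
    case (add x R)
    have "(\<Sum>a\<in>set_mset R. real (count R a) * a ^ k) =
        (\<Sum>a\<in>insert x (set_mset R). real (count R a) * a ^ k)"
      by (intro sum.mono_neutral_left) (auto simp: not_in_iff)
    moreover have "(\<Sum>a\<in>insert x (set_mset R). of_bool (a = x) * a ^ k) = x ^ k"
      by (simp add: of_bool_def if_distribR if_distrib[of "\<lambda>z. z * _"] cong: if_cong)
    moreover have "real (count (add_mset x R) a) = of_bool (a = x) + real (count R a)" for a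
      by simp
    ultimately show ?case
      using add by (simp only: distrib_right sum.distrib set_mset_add_mset_insert) simp
  qed simp
  also have "\<dots> = (\<Sum>i<n. (A ^\<^sub>m k) $$ (i, i))"
    unfolding R_def by (rule power_sum_proots_char_poly[OF A es(1)])
  finally show "measure_pmf.expectation (spectral_pmf A) (\<lambda>x. x ^ k) = (\<Sum>i<n. (A ^\<^sub>m k) $$ (i, i)) / real n" .
qed

subsection \<open>Moments of the expected spectral measure\<close>

lemma finite_set_Pi_pmf_bool:
  "finite A \<Longrightarrow> finite (set_pmf (Pi_pmf A False (p :: 'a \<Rightarrow> bool pmf)))"
  by (simp add: set_Pi_pmf finite_PiE_dflt)

text \<open>Condition on the coordinate \<open>x\<close>, which is independent of the others. On the
  right the integrand ignores \<open>e x\<close>, so both cases contribute the same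
  expectation.\<close>

lemma expectation_bernoulli_coordinate:
  fixes F :: "('a \<Rightarrow> bool) \<Rightarrow> real"
  assumes "finite A" "x \<in> A" "0 \<le> p" "p \<le> 1"
  defines "P \<equiv> Pi_pmf A False (\<lambda>_. bernoulli_pmf p)"
  shows "measure_pmf.expectation P (\<lambda>e. of_bool (e x) * F e) =
    p * measure_pmf.expectation P (\<lambda>e. F (e(x := True)))"
proof -
  define Q where "Q = Pi_pmf (A - {x}) False (\<lambda>_. bernoulli_pmf p)"
  have fin: "finite (set_pmf Q)"
    unfolding Q_def using assms by (intro finite_set_Pi_pmf_bool) auto
  have "P = Pi_pmf (insert x (A - {x})) False (\<lambda>_. bernoulli_pmf p)"
    unfolding P_def using assms by (simp add: insert_absorb)
  also have "\<dots> = bernoulli_pmf p \<bind> (\<lambda>y. map_pmf (\<lambda>e. e(x := y)) Q)"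
    unfolding Q_def using assms by (subst Pi_pmf_insert') (auto simp: map_pmf_def)
  finally have P: "P = bernoulli_pmf p \<bind> (\<lambda>y. map_pmf (\<lambda>e. e(x := y)) Q)" .
  have expand: "measure_pmf.expectation P H = p * measure_pmf.expectation Q (\<lambda>e. H (e(x := True)))
      + (1 - p) * measure_pmf.expectation Q (\<lambda>e. H (e(x := False)))" for H :: "('a \<Rightarrow> bool) \<Rightarrow> real"
    unfolding P using fin assms(3,4)
    by (subst pmf_expectation_bind[where A = UNIV]) (auto simp: UNIV_bool)
  show ?thesis
    unfolding expand[of "\<lambda>e. of_bool (e x) * F e"] expand[of "\<lambda>e. F (e(x := True))"]
    by (simp add: algebra_simps)
qed

lemma pow_mat_Suc_left:
  fixes A :: "'a :: semiring_1 mat"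
  assumes "A \<in> carrier_mat n n"
  shows "A ^\<^sub>m Suc k = A * A ^\<^sub>m k"
proof (induction k)
  case (Suc k)
  have "A ^\<^sub>m Suc (Suc k) = A * A ^\<^sub>m k * A" using Suc by simp
  also have "\<dots> = A * (A ^\<^sub>m k * A)"
    using assms by (intro assoc_mult_mat[where n\<^sub>1 = n and n\<^sub>2 = n and n\<^sub>3 = n and n\<^sub>4 = n]) auto
  finally show ?case by simp
qed (use assms in simp)

lemma pow_mat_smult:
  fixes A :: "'a :: comm_semiring_1 mat"
  assumes "A \<in> carrier_mat n n"
  shows "(c \<cdot>\<^sub>m A) ^\<^sub>m k = c ^ k \<cdot>\<^sub>m A ^\<^sub>m k"
proof (induction k)
  case (Suc k)
  have "(c \<cdot>\<^sub>m A) ^\<^sub>m Suc k = (c ^ k \<cdot>\<^sub>m A ^\<^sub>m k) * (c \<cdot>\<^sub>m A)" using Suc by simp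
  also have "\<dots> = c ^ Suc k \<cdot>\<^sub>m (A ^\<^sub>m k * A)"
    using assms by (intro eq_matI) (auto simp: scalar_prod_def sum_distrib_left mult_ac)
  finally show ?case by simp
qed (use assms in \<open>auto intro!: eq_matI\<close>)

lemma adjacency_matrix_carrier [simp]: "adjacency_matrix n e \<in> carrier_mat n n"
  by (simp add: adjacency_matrix_def)

lemma adjacency_matrix_entry:
  "i < n \<Longrightarrow> j < n \<Longrightarrow> adjacency_matrix n e $$ (i, j) = (if i = j then 0 else of_bool (e (edge i j)))"
  by (simp add: adjacency_matrix_def edge_def)

definition possible_edges :: "nat \<Rightarrow> (nat \<times> nat) set" where
  "possible_edges n = {(i, j). i < j \<and> j < n}"

lemma finite_possible_edges: "finite (possible_edges n)"
  by (rule finite_subset[of _ "{..<n} \<times> {..<n}"]) (auto simp: possible_edges_def)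

text \<open>\<open>E\<close> holds the edges already revealed as present. Exposing the first step of
  the walk costs nothing if its edge lies in \<open>E\<close>, and otherwise a factor
  \<open>p\<close>, after which the edge is forced.\<close>

lemma expectation_forced_adjacency_power:
  assumes p: "0 \<le> p" "p \<le> 1" and "u < n" "r < n"
  defines "P \<equiv> Pi_pmf (possible_edges n) False (\<lambda>_. bernoulli_pmf p)"
  shows "measure_pmf.expectation P (\<lambda>e. (adjacency_matrix n (\<lambda>x. x \<in> E \<or> e x) ^\<^sub>m s) $$ (u, r)) =
    walk_weight n p r s E u"
  using assms(3)
proof (induction s arbitrary: E u)
  case 0
  then show ?case using \<open>r < n\<close> by (simp add: adjacency_matrix_def)
next
  case (Suc s)
  define X where "X E e = adjacency_matrix n (\<lambda>x. x \<in> E \<or> e x)" for E e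
  have X: "X E e \<in> carrier_mat n n" for E e by (simp add: X_def)
  have fin: "finite (set_pmf P)"
    unfolding P_def by (intro finite_set_Pi_pmf_bool finite_possible_edges)
  have entry: "(X E e ^\<^sub>m Suc s) $$ (u, r) =
      (\<Sum>v\<in>{..<n} - {u}. of_bool (edge u v \<in> E \<or> e (edge u v)) * (X E e ^\<^sub>m s) $$ (v, r))" for e
  proof -
    have "(X E e ^\<^sub>m Suc s) $$ (u, r) = (\<Sum>v<n. X E e $$ (u, v) * (X E e ^\<^sub>m s) $$ (v, r))"
      unfolding pow_mat_Suc_left[OF X] using X[of E e] Suc.prems \<open>r < n\<close>
      by (simp add: scalar_prod_def atLeast0LessThan)
    also have "\<dots> = (\<Sum>v\<in>{..<n} - {u}. X E e $$ (u, v) * (X E e ^\<^sub>m s) $$ (v, r))"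
      using Suc.prems by (intro sum.mono_neutral_right) (auto simp: X_def adjacency_matrix_entry)
    also have "\<dots> = (\<Sum>v\<in>{..<n} - {u}. of_bool (edge u v \<in> E \<or> e (edge u v)) * (X E e ^\<^sub>m s) $$ (v, r))"
      using Suc.prems by (intro sum.cong) (auto simp: X_def adjacency_matrix_entry)
    finally show ?thesis .
  qed
  have step: "measure_pmf.expectation P
        (\<lambda>e. of_bool (edge u v \<in> E \<or> e (edge u v)) * (X E e ^\<^sub>m s) $$ (v, r)) =
      (if edge u v \<in> E then 1 else p) * walk_weight n p r s (insert (edge u v) E) v"
    if v: "v \<in> {..<n} - {u}" for v
  proof (cases "edge u v \<in> E")
    case True
    then show ?thesis using Suc.IH[of v E] v by (simp add: X_def insert_absorb)
  next
    case False
    have "edge u v \<in> possible_edges n"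
      using v Suc.prems by (auto simp: edge_def possible_edges_def min_def max_def)
    moreover have "X E (e(edge u v := True)) = X (insert (edge u v) E) e" for e
      unfolding X_def by (rule arg_cong[where f = "adjacency_matrix n"]) auto
    ultimately show ?thesis
      using expectation_bernoulli_coordinate[OF finite_possible_edges _ p,
          of "edge u v" n "\<lambda>e. (X E e ^\<^sub>m s) $$ (v, r)"] False Suc.IH[of v "insert (edge u v) E"] v
      by (simp add: P_def X_def)
  qed
  have "measure_pmf.expectation P (\<lambda>e. (X E e ^\<^sub>m Suc s) $$ (u, r)) =
      (\<Sum>v\<in>{..<n} - {u}. measure_pmf.expectation P
        (\<lambda>e. of_bool (edge u v \<in> E \<or> e (edge u v)) * (X E e ^\<^sub>m s) $$ (v, r)))"
    unfolding entry by (intro Bochner_Integration.integral_sum integrable_measure_pmf_finite fin)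
  also have "\<dots> = walk_weight n p r (Suc s) E u"
    unfolding walk_weight.simps by (intro sum.cong refl step)
  finally show ?case by (simp add: X_def)
qed

text \<open>The bound \<open>n \<ge> c\<close> makes \<open>c / n\<close> a genuine probability.
  There are finitely many graphs, each with finite spectrum, so every moment is a finite sum and
  reduces to expected traces.\<close>

lemma expected_spectral_measure_moment:
  assumes c: "c > 0" and n: "real n \<ge> c"
  shows "integrable (expected_spectral_measure c n) (\<lambda>x. x ^ k)"
    and "(LINT x|expected_spectral_measure c n. x ^ k) =
      (1 / sqrt c) ^ k * ((\<Sum>r<n. walk_weight n (c / real n) r k {} r) / real n)"
proof -
  define p where "p = c / real n"
  define P where "P = Pi_pmf (possible_edges n) False (\<lambda>_. bernoulli_pmf p)"
  define G where "G = erdos_renyi n p"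
  define B where "B = G \<bind> normalised_spectral_pmf c"
  have n0: "n > 0" using c n by (cases n) auto
  have p: "0 \<le> p" "p \<le> 1" using c n n0 by (auto simp: p_def)
  have G: "G = map_pmf (adjacency_matrix n) P"
    by (simp add: G_def erdos_renyi_def P_def possible_edges_def)
  have finP: "finite (set_pmf P)"
    unfolding P_def by (intro finite_set_Pi_pmf_bool finite_possible_edges)
  have finG: "finite (set_pmf G)" unfolding G using finP by simp
  have spec: "finite (set_pmf (normalised_spectral_pmf c X))"
    "measure_pmf.expectation (normalised_spectral_pmf c X) (\<lambda>x. x ^ k) =
      (1 / sqrt c) ^ k * ((\<Sum>r<n. (X ^\<^sub>m k) $$ (r, r)) / real n)" if XG: "X \<in> set_pmf G" for X
  proof -
    obtain e where X: "X = adjacency_matrix n e" using XG by (auto simp: G)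
    let ?Y = "(1 / sqrt c) \<cdot>\<^sub>m X"
    have Y: "?Y \<in> carrier_mat n n" by (simp add: X)
    have sym: "?Y $$ (i, j) = ?Y $$ (j, i)" if "i < n" "j < n" for i j
    proof -
      have "X $$ (i, j) = X $$ (j, i)"
        unfolding X using that by (simp add: adjacency_matrix_entry edge_commute)
      then show ?thesis using that by (simp add: X adjacency_matrix_def)
    qed
    show "finite (set_pmf (normalised_spectral_pmf c X))"
      unfolding normalised_spectral_pmf_def by (rule expectation_spectral_pmf[OF Y n0 sym])
    have "measure_pmf.expectation (normalised_spectral_pmf c X) (\<lambda>x. x ^ k) =
        (\<Sum>r<n. (?Y ^\<^sub>m k) $$ (r, r)) / real n"
      unfolding normalised_spectral_pmf_def by (rule expectation_spectral_pmf[OF Y n0 sym])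
    also have "(\<Sum>r<n. (?Y ^\<^sub>m k) $$ (r, r)) = (1 / sqrt c) ^ k * (\<Sum>r<n. (X ^\<^sub>m k) $$ (r, r))"
    proof -
      have "X \<in> carrier_mat n n" by (simp add: X)
      then show ?thesis by (simp add: pow_mat_smult sum_distrib_left)
    qed
    finally show "measure_pmf.expectation (normalised_spectral_pmf c X) (\<lambda>x. x ^ k) =
      (1 / sqrt c) ^ k * ((\<Sum>r<n. (X ^\<^sub>m k) $$ (r, r)) / real n)" by simp
  qed
  have B: "expected_spectral_measure c n = distr (measure_pmf B) borel (\<lambda>x. x)"
    by (simp add: expected_spectral_measure_def B_def G_def p_def)
  have "finite (set_pmf B)" unfolding B_def using finG spec(1) by simp
  then have "integrable (measure_pmf B) (\<lambda>x. x ^ k)" by (rule integrable_measure_pmf_finite)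
  then show "integrable (expected_spectral_measure c n) (\<lambda>x. x ^ k)"
    unfolding B by (subst integrable_distr_eq) auto
  have "(LINT x|expected_spectral_measure c n. x ^ k) = measure_pmf.expectation B (\<lambda>x. x ^ k)"
    unfolding B by (subst integral_distr) auto
  also have "\<dots> = (\<Sum>X\<in>set_pmf G. pmf G X *\<^sub>R measure_pmf.expectation (normalised_spectral_pmf c X) (\<lambda>x. x ^ k))"
    unfolding B_def by (rule pmf_expectation_bind) (use finG spec(1) in auto)
  also have "\<dots> = (\<Sum>X\<in>set_pmf G. pmf G X *\<^sub>R ((1 / sqrt c) ^ k * ((\<Sum>r<n. (X ^\<^sub>m k) $$ (r, r)) / real n)))"
    by (intro sum.cong) (simp_all only: spec(2))
  also have "\<dots> = measure_pmf.expectation G (\<lambda>X. (1 / sqrt c) ^ k * ((\<Sum>r<n. (X ^\<^sub>m k) $$ (r, r)) / real n))"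
    by (rule integral_measure_pmf[symmetric]) (use finG in auto)
  also have "\<dots> = (1 / sqrt c) ^ k * (measure_pmf.expectation G (\<lambda>X. \<Sum>r<n. (X ^\<^sub>m k) $$ (r, r)) / real n)"
    by simp
  also have "measure_pmf.expectation G (\<lambda>X. \<Sum>r<n. (X ^\<^sub>m k) $$ (r, r)) =
      (\<Sum>r<n. measure_pmf.expectation P (\<lambda>e. (adjacency_matrix n e ^\<^sub>m k) $$ (r, r)))"
    unfolding G integral_map_pmf
    by (intro Bochner_Integration.integral_sum integrable_measure_pmf_finite finP)
  also have "\<dots> = (\<Sum>r<n. walk_weight n p r k {} r)"
    using expectation_forced_adjacency_power[OF p, of _ n _ "{}" k] by (intro sum.cong) (auto simp: P_def)
  finally show "(LINT x|expected_spectral_measure c n. x ^ k) =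
      (1 / sqrt c) ^ k * ((\<Sum>r<n. walk_weight n (c / real n) r k {} r) / real n)"
    by (simp add: p_def)
qed

subsection \<open>Moments of the semicircle law and of its correction\<close>

text \<open>Substitute \<open>x = 2 * cos t\<close>: the Jacobian \<open>2 * sin t\<close> cancels
  \<open>sqrt (4 - x\<^sup>2)\<close>, and the endpoint singularities disappear.\<close>

lemma inverse_sqrt_weight_integral:
  fixes q :: "real \<Rightarrow> real"
  assumes q: "continuous_on UNIV q"
  defines "f \<equiv> \<lambda>x. if \<bar>x\<bar> < 2 then q x / sqrt (4 - x\<^sup>2) else 0"
  shows "integrable lborel f" "integral\<^sup>L lborel f = integral {0..pi} (\<lambda>t. q (2 * cos t))"
proof -
  let ?S = "{0<..<pi}" and ?g = "\<lambda>t::real. 2 * cos t" and ?h = "\<lambda>x. q x / sqrt (4 - x\<^sup>2)"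
  have sin_pos: "0 < sin t" if "t \<in> ?S" for t
    using that by (simp add: sin_gt_zero)
  have inj: "inj_on ?g ?S"
  proof (rule inj_onI)
    fix s t assume "s \<in> ?S" "t \<in> ?S" "?g s = ?g t"
    then show "s = t" using cos_inj_pi[of s t] by simp
  qed
  have image: "?g ` ?S = {-2<..<2}"
  proof (intro equalityI subsetI)
    fix x :: real assume "x \<in> ?g ` ?S"
    then obtain t where t: "t \<in> ?S" "x = 2 * cos t" by blast
    have "cos t < cos 0" "cos pi < cos t"
      using t by (intro cos_monotone_0_pi; simp)+
    then show "x \<in> {-2<..<2}" using t by simp
  next
    fix x :: real assume x: "x \<in> {-2<..<2}"
    have "0 < arccos (x / 2)" "arccos (x / 2) < pi"
      using x arccos_lt_bounded[of "x / 2"] by auto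
    moreover have "x = 2 * cos (arccos (x / 2))" using x by simp
    ultimately show "x \<in> ?g ` ?S" by (intro image_eqI[of _ _ "arccos (x / 2)"]) auto
  qed
  have weight: "\<bar>- 2 * sin t\<bar> * ?h (?g t) = q (2 * cos t)" if "t \<in> ?S" for t
  proof -
    have "sqrt (4 - (2 * cos t)\<^sup>2) = 2 * sin t"
      using sin_pos[OF that] by (intro real_sqrt_unique) (simp_all add: power_mult_distrib sin_squared_eq)
    then show ?thesis using sin_pos[OF that] by (simp add: abs_mult)
  qed
  have qint: "(\<lambda>t. q (2 * cos t)) absolutely_integrable_on {0..pi}"
    by (intro absolutely_integrable_continuous_real continuous_intros continuous_on_compose2[OF q]) auto
  have "(\<lambda>t. q (2 * cos t)) absolutely_integrable_on ?S"
    by (rule set_integrable_subset[OF qint]) auto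
  then have "(\<lambda>t. \<bar>- 2 * sin t\<bar> * ?h (?g t)) absolutely_integrable_on ?S"
    by (rule absolutely_integrable_spike[where S = "{}"]) (use weight in auto)
  moreover have "integral ?S (\<lambda>t. \<bar>- 2 * sin t\<bar> * ?h (?g t)) = integral {0..pi} (\<lambda>t. q (2 * cos t))"
  proof -
    have "integral ?S (\<lambda>t. \<bar>- 2 * sin t\<bar> * ?h (?g t)) = integral ?S (\<lambda>t. q (2 * cos t))"
      by (rule integral_cong) (rule weight)
    also have "\<dots> = integral {0..pi} (\<lambda>t. q (2 * cos t))"
      by (rule integral_open_interval_real[symmetric])
    finally show ?thesis .
  qed
  moreover have "(?g has_field_derivative (- 2 * sin t)) (at t within ?S)" for t
    by (auto intro!: derivative_eq_intros)
  ultimately have *: "?h absolutely_integrable_on {-2<..<2}"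
      "integral {-2<..<2} ?h = integral {0..pi} (\<lambda>t. q (2 * cos t))"
    using has_absolute_integral_change_of_variables_1'[OF _ _ inj, of "\<lambda>t. - 2 * sin t" ?h] image
    by (metis lmeasurable_box fmeasurableD box_real(1))+
  have f: "f = (\<lambda>x. indicat_real {-2<..<2} x *\<^sub>R ?h x)"
    by (auto simp: f_def fun_eq_iff indicator_def abs_less_iff)
  have [measurable]: "q \<in> borel_measurable borel"
    using q by (rule borel_measurable_continuous_onI)
  have meas: "f \<in> borel_measurable lborel"
    unfolding f_def by measurable
  \<comment> \<open>The change of variables lives on the completed measure; Borel measurability of
    \<open>f\<close> brings both claims back to \<open>lborel\<close>.\<close>
  have int: "integrable lebesgue f"
    using *(1) by (simp add: set_integrable_def f)
  then show "integrable lborel f"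
    using integrable_completion[OF meas] by simp
  have "integral\<^sup>L lborel f = integral\<^sup>L lebesgue f"
    using integral_completion[OF meas] by simp
  also have "\<dots> = integral {-2<..<2} ?h"
    using set_lebesgue_integral_eq_integral(2)[OF *(1)] by (simp add: set_lebesgue_integral_def f)
  finally show "integral\<^sup>L lborel f = integral {0..pi} (\<lambda>t. q (2 * cos t))"
    using *(2) by simp
qed

lemma correction_moment:
  "has_signed_moment k semicircle_correction_density"
  "signed_moment k semicircle_correction_density = cos_coeff k 4"
proof -
  let ?q = "\<lambda>x::real. 1 / (2 * pi) * (x ^ k * (x ^ 4 - 4 * x\<^sup>2 + 2))"
  have eq: "(\<lambda>x. x ^ k * semicircle_correction_density x) =
      (\<lambda>x. if \<bar>x\<bar> < 2 then ?q x / sqrt (4 - x\<^sup>2) else 0)"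
    by (auto simp: semicircle_correction_density_def)
  have q: "continuous_on UNIV ?q" by (intro continuous_intros)
  show "has_signed_moment k semicircle_correction_density"
    unfolding has_signed_moment_def eq by (rule inverse_sqrt_weight_integral(1)[OF q])
  have "?q (2 * cos t) = 1 / pi * ((2 * cos t) ^ k * cos (of_int 4 * t))" for t
  proof -
    have "cos (4 * t) = 2 * (cos (2 * t))\<^sup>2 - 1"
      using cos_double_cos[of "2 * t"] by simp
    then have "cos (4 * t) = 8 * cos t ^ 4 - 8 * (cos t)\<^sup>2 + 1"
      unfolding cos_double_cos by (simp add: power2_eq_square power4_eq_xxxx algebra_simps)
    then have "(2 * cos t) ^ 4 - 4 * (2 * cos t)\<^sup>2 + 2 = 2 * cos (of_int 4 * t)"
      by (simp add: power_mult_distrib)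
    then show ?thesis by simp
  qed
  then have "integral {0..pi} (\<lambda>t. ?q (2 * cos t)) = cos_coeff k 4"
    unfolding cos_coeff_def by simp
  then show "signed_moment k semicircle_correction_density = cos_coeff k 4"
    unfolding signed_moment_def eq inverse_sqrt_weight_integral(2)[OF q] .
qed

lemma semicircle_moment:
  "has_signed_moment k semicircle_density"
  "signed_moment k semicircle_density = cos_coeff k 0 - cos_coeff k 2"
proof -
  let ?q = "\<lambda>x::real. 1 / (2 * pi) * (x ^ k * (4 - x\<^sup>2))"
  \<comment> \<open>Writing the root as a quotient brings the semicircle density into the form of
    the inverse square root weight.\<close>
  have weight: "sqrt (4 - x\<^sup>2) = (4 - x\<^sup>2) / sqrt (4 - x\<^sup>2)" if "\<bar>x\<bar> < 2" for x :: real
  proof -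
    have "x\<^sup>2 < 4" using that abs_le_square_iff[of 2 x] by simp
    then show ?thesis by (simp add: real_div_sqrt)
  qed
  have eq: "(\<lambda>x. x ^ k * semicircle_density x) =
      (\<lambda>x. if \<bar>x\<bar> < 2 then ?q x / sqrt (4 - x\<^sup>2) else 0)"
  proof
    fix x :: real
    show "x ^ k * semicircle_density x = (if \<bar>x\<bar> < 2 then ?q x / sqrt (4 - x\<^sup>2) else 0)"
    proof (cases "\<bar>x\<bar> < 2")
      case True
      then have "semicircle_density x = 1 / (2 * pi) * ((4 - x\<^sup>2) / sqrt (4 - x\<^sup>2))"
        using weight[OF True] by (simp only: semicircle_density_def if_True)
      with True show ?thesis by simp
    qed (simp add: semicircle_density_def)
  qed
  have q: "continuous_on UNIV ?q" by (intro continuous_intros)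
  show "has_signed_moment k semicircle_density"
    unfolding has_signed_moment_def eq by (rule inverse_sqrt_weight_integral(1)[OF q])
  have "?q (2 * cos t) = 1 / pi * ((2 * cos t) ^ k * cos (of_int 0 * t) - (2 * cos t) ^ k * cos (of_int 2 * t))" for t
  proof -
    have "4 - (2 * cos t)\<^sup>2 = 2 * (cos (of_int 0 * t) - cos (of_int 2 * t))"
      by (simp add: cos_double_cos power_mult_distrib)
    then show ?thesis by (simp only: right_diff_distrib)
  qed
  then have "integral {0..pi} (\<lambda>t. ?q (2 * cos t)) = 1 / pi *
      integral {0..pi} (\<lambda>t. (2 * cos t) ^ k * cos (of_int 0 * t) - (2 * cos t) ^ k * cos (of_int 2 * t))"
    by simp
  also have "\<dots> = cos_coeff k 0 - cos_coeff k 2"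
    unfolding cos_coeff_def
    by (simp only: Henstock_Kurzweil_Integration.integral_diff[OF integrable_cos_coeff integrable_cos_coeff]
        right_diff_distrib)
  finally show "signed_moment k semicircle_density = cos_coeff k 0 - cos_coeff k 2"
    unfolding signed_moment_def eq inverse_sqrt_weight_integral(2)[OF q] .
qed

subsection \<open>Convergence of moments under weak convergence\<close>

text \<open>A bounded continuous truncation, so that weak convergence applies to its powers.\<close>

definition clip :: "real \<Rightarrow> real \<Rightarrow> real" where
  "clip R x = max (- R) (min R x)"

lemma isCont_clip_power: "isCont (\<lambda>x. clip R x ^ k) x"
  unfolding clip_def by (intro continuous_intros)

lemma abs_clip_le: "R \<ge> 0 \<Longrightarrow> \<bar>clip R x\<bar> \<le> R" "R \<ge> 0 \<Longrightarrow> \<bar>clip R x\<bar> \<le> \<bar>x\<bar>"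
  by (auto simp: clip_def)

text \<open>Only \<open>\<bar>x\<bar> > R\<close> matters, where one extra factor
  \<open>\<bar>x\<bar>\<close> pays for \<open>1 / R\<close>. The exponent \<open>2 * k + 2\<close>
  is even and at least \<open>k + 1\<close>, so the bound is nonnegative.\<close>

lemma clip_power_error:
  assumes "R \<ge> 1"
  shows "\<bar>x ^ k - clip R x ^ k\<bar> \<le> 2 / R * x ^ (2 * k + 2)"
proof (cases "\<bar>x\<bar> \<le> R")
  case True
  then have "clip R x = x" by (auto simp: clip_def)
  moreover have "0 \<le> x ^ (2 * k + 2)" by (intro zero_le_even_power) simp
  ultimately show ?thesis using assms by simp
next
  case False
  have "\<bar>clip R x\<bar> ^ k \<le> \<bar>x\<bar> ^ k"
    using assms by (intro power_mono abs_clip_le) auto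
  then have 1: "\<bar>x ^ k - clip R x ^ k\<bar> \<le> 2 * \<bar>x\<bar> ^ k"
    using abs_triangle_ineq4[of "x ^ k" "clip R x ^ k"] by (simp add: power_abs)
  have "R * \<bar>x\<bar> ^ k \<le> \<bar>x\<bar> * \<bar>x\<bar> ^ k"
    using False by (intro mult_right_mono) auto
  also have "\<dots> = \<bar>x\<bar> ^ (k + 1)" by simp
  also have "\<dots> \<le> \<bar>x\<bar> ^ (2 * k + 2)"
    using False assms by (intro power_increasing) auto
  also have "\<dots> = x ^ (2 * k + 2)" by (simp add: power_even_abs)
  finally have "\<bar>x\<bar> ^ k \<le> x ^ (2 * k + 2) / R"
    using assms by (simp add: field_simps)
  with 1 show ?thesis by simp
qed

lemma (in real_distribution) integrable_clip_power: "R \<ge> 0 \<Longrightarrow> integrable M (\<lambda>x. clip R x ^ k)"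
  by (rule integrable_const_bound[where B = "R ^ k"])
    (auto simp: power_abs abs_clip_le intro!: power_mono, simp add: clip_def)

lemma (in real_distribution) integral_clip_power_error:
  assumes "R \<ge> 1" "integrable M (\<lambda>x. x ^ k)" "integrable M (\<lambda>x. x ^ (2 * k + 2))"
  shows "\<bar>(LINT x|M. x ^ k) - (LINT x|M. clip R x ^ k)\<bar> \<le> 2 / R * (LINT x|M. x ^ (2 * k + 2))"
proof -
  have ic: "integrable M (\<lambda>x. clip R x ^ k)" using assms(1) by (intro integrable_clip_power) auto
  have "\<bar>(LINT x|M. x ^ k) - (LINT x|M. clip R x ^ k)\<bar> = \<bar>LINT x|M. x ^ k - clip R x ^ k\<bar>"
    using assms ic by simp
  also have "\<dots> \<le> (LINT x|M. \<bar>x ^ k - clip R x ^ k\<bar>)"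
    by (rule integral_abs_bound)
  also have "\<dots> \<le> (LINT x|M. 2 / R * x ^ (2 * k + 2))"
    using assms ic clip_power_error[OF assms(1)] by (intro integral_mono) auto
  finally show ?thesis by simp
qed

context
  fixes \<mu> :: "nat \<Rightarrow> real measure" and M :: "real measure" and L :: "nat \<Rightarrow> real"
  assumes \<mu>: "\<And>n. real_distribution (\<mu> n)" and M: "real_distribution M"
    and conv: "weak_conv_m \<mu> M"
    and int: "\<And>k. eventually (\<lambda>n. integrable (\<mu> n) (\<lambda>x. x ^ k)) sequentially"
    and lim: "\<And>k. (\<lambda>n. LINT x|\<mu> n. x ^ k) \<longlonglongrightarrow> L k"
begin

interpretation M: real_distribution M by (rule M)

lemma tendsto_integral_clip_power:
  assumes "R \<ge> 0"
  shows "(\<lambda>n. LINT x|\<mu> n. clip R x ^ k) \<longlonglongrightarrow> (LINT x|M. clip R x ^ k)"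
  by (rule weak_conv_imp_integral_bdd_continuous_conv[OF \<mu> M conv, where B = "R ^ k"])
    (use assms in \<open>auto simp: power_abs abs_clip_le intro!: power_mono isCont_clip_power\<close>)

text \<open>Monotone convergence: the truncated even moments of \<open>M\<close> increase with the
  cutoff and stay below \<open>L (2 * j)\<close>, being limits of integrals bounded by the full
  moments.\<close>

lemma weak_limit_integrable_even_power: "integrable M (\<lambda>x. x ^ (2 * j))"
proof -
  let ?I = "\<lambda>i::nat. LINT x|M. clip (real i) x ^ (2 * j)"
  have ic: "integrable M (\<lambda>x. clip (real i) x ^ (2 * j))" for i
    by (rule M.integrable_clip_power) simp
  have mono: "clip (real i) x ^ (2 * j) \<le> clip (real i') x ^ (2 * j)" if "i \<le> i'" for i i' x
  proof -
    have "\<bar>clip (real i) x\<bar> \<le> \<bar>clip (real i') x\<bar>" using that by (auto simp: clip_def)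
    then have "\<bar>clip (real i) x\<bar> ^ (2 * j) \<le> \<bar>clip (real i') x\<bar> ^ (2 * j)" by (intro power_mono) auto
    then show ?thesis by (simp add: power_even_abs)
  qed
  have "?I i \<le> L (2 * j)" for i
  proof (rule tendsto_le[OF _ lim tendsto_integral_clip_power])
    show "\<forall>\<^sub>F n in sequentially. (LINT x|\<mu> n. clip (real i) x ^ (2 * j)) \<le> (LINT x|\<mu> n. x ^ (2 * j))"
      using int[of "2 * j"]
    proof eventually_elim
      case (elim n)
      interpret real_distribution "\<mu> n" by (rule \<mu>)
      have "clip (real i) x ^ (2 * j) \<le> x ^ (2 * j)" for x
        using power_mono[OF abs_clip_le(2)[of "real i" x], of "2 * j"] by (simp add: power_even_abs)
      then show ?case
        by (intro integral_mono elim integrable_clip_power) auto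
    qed
  qed auto
  moreover have "incseq ?I"
    by (intro incseq_SucI integral_mono ic mono) auto
  ultimately obtain l where l: "?I \<longlonglongrightarrow> l"
    using incseq_convergent[of ?I "L (2 * j)"] by blast
  show ?thesis
  proof (rule integrable_monotone_convergence[OF ic _ _ l])
    show "AE x in M. mono (\<lambda>n. clip (real n) x ^ (2 * j))"
      using mono by (auto simp: mono_def)
    have "(\<lambda>n. clip (real n) x ^ (2 * j)) \<longlonglongrightarrow> x ^ (2 * j)" for x
    proof (rule tendsto_eventually)
      show "\<forall>\<^sub>F n in sequentially. clip (real n) x ^ (2 * j) = x ^ (2 * j)"
        using eventually_ge_at_top[of "nat \<lceil>\<bar>x\<bar>\<rceil>"]
      proof eventually_elim
        case (elim n)
        then have "\<bar>x\<bar> \<le> real n" by linarith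
        then have "clip (real n) x = x" by (auto simp: clip_def)
        then show ?case by simp
      qed
    qed
    then show "AE x in M. (\<lambda>n. clip (real n) x ^ (2 * j)) \<longlonglongrightarrow> x ^ (2 * j)" by simp
  qed simp
qed

lemma weak_limit_integrable_power: "integrable M (\<lambda>x. x ^ k)"
proof (rule Bochner_Integration.integrable_bound)
  show "integrable M (\<lambda>x. 1 + x ^ (2 * k))"
    by (intro Bochner_Integration.integrable_add weak_limit_integrable_even_power) simp
  have "\<bar>x ^ k\<bar> \<le> 1 + x ^ (2 * k)" for x :: real
  proof -
    \<comment> \<open>Expanding gives \<open>\<bar>y\<bar> \<le> y ^ 2 + 1 / 4\<close> for
      \<open>y = x ^ k\<close>.\<close>
    have "0 \<le> (\<bar>x ^ k\<bar> - 1 / 2)\<^sup>2" by simp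
    then show ?thesis by (simp add: power2_eq_square algebra_simps power_mult flip: abs_mult power_mult_distrib)
  qed
  then show "AE x in M. norm (x ^ k) \<le> norm (1 + x ^ (2 * k))"
    by (simp add: abs_of_nonneg add_nonneg_nonneg)
qed simp

text \<open>First \<open>n\<close>, then \<open>R\<close> tends to infinity: the truncation errors
  are controlled by moments of order \<open>2 * k + 2\<close>, which converge, so the limiting error
  is at most \<open>C / R\<close>.\<close>

lemma weak_limit_moment: "(LINT x|M. x ^ k) = L k"
proof -
  let ?m = "\<lambda>N. LINT x|N. x ^ (2 * k + 2)"
  define C where "C = 2 * (?m M + L (2 * k + 2))"
  have bound: "\<bar>(LINT x|M. x ^ k) - L k\<bar> \<le> C / R" if R: "R \<ge> 1" for R
  proof (rule tendsto_le)
    show "(\<lambda>n. \<bar>(LINT x|M. x ^ k) - (LINT x|\<mu> n. x ^ k)\<bar>) \<longlonglongrightarrow> \<bar>(LINT x|M. x ^ k) - L k\<bar>"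
      by (intro tendsto_intros lim)
    have "(\<lambda>n. 2 / R * ?m M + 2 / R * ?m (\<mu> n) + \<bar>(LINT x|M. clip R x ^ k) - (LINT x|\<mu> n. clip R x ^ k)\<bar>)
        \<longlonglongrightarrow> 2 / R * ?m M + 2 / R * L (2 * k + 2) + \<bar>(LINT x|M. clip R x ^ k) - (LINT x|M. clip R x ^ k)\<bar>"
      using R by (intro tendsto_intros lim tendsto_integral_clip_power) auto
    also have "2 / R * ?m M + 2 / R * L (2 * k + 2) + \<bar>(LINT x|M. clip R x ^ k) - (LINT x|M. clip R x ^ k)\<bar> = C / R"
      by (simp add: C_def add_divide_distrib distrib_left)
    finally show "(\<lambda>n. 2 / R * ?m M + 2 / R * ?m (\<mu> n) + \<bar>(LINT x|M. clip R x ^ k) - (LINT x|\<mu> n. clip R x ^ k)\<bar>)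
        \<longlonglongrightarrow> C / R" .
    show "\<forall>\<^sub>F n in sequentially. \<bar>(LINT x|M. x ^ k) - (LINT x|\<mu> n. x ^ k)\<bar>
        \<le> 2 / R * ?m M + 2 / R * ?m (\<mu> n) + \<bar>(LINT x|M. clip R x ^ k) - (LINT x|\<mu> n. clip R x ^ k)\<bar>"
      using int[of k] int[of "2 * k + 2"]
    proof eventually_elim
      case (elim n)
      have "\<bar>(LINT x|M. x ^ k) - (LINT x|M. clip R x ^ k)\<bar> \<le> 2 / R * ?m M"
        by (intro M.integral_clip_power_error R weak_limit_integrable_power)
      moreover have "\<bar>(LINT x|\<mu> n. x ^ k) - (LINT x|\<mu> n. clip R x ^ k)\<bar> \<le> 2 / R * ?m (\<mu> n)"
        by (intro real_distribution.integral_clip_power_error \<mu> R elim)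
      ultimately show ?case by linarith
    qed
  qed simp
  have "(\<lambda>i. C / real i) \<longlonglongrightarrow> 0" by (rule lim_const_over_n)
  then have "\<bar>(LINT x|M. x ^ k) - L k\<bar> \<le> 0"
    by (rule LIMSEQ_le_const) (use bound in \<open>auto intro!: exI[of _ 1]\<close>)
  then show ?thesis by simp
qed

end

subsection \<open>The expansion of the moments\<close>

lemma moment_limiting_spectral_measure:
  assumes c: "c > 0" and lim: "limiting_spectral_measure c M"
  shows "integrable M (\<lambda>x. x ^ k)" "moment k M = tree_walks 1 (1 / c) k [] (\<lambda>_. 0)"
proof -
  let ?\<mu> = "expected_spectral_measure c" and ?L = "\<lambda>k. (1 / sqrt c) ^ k * tree_walks c 1 k [] (\<lambda>_. 0)"
  have distr: "real_distribution (?\<mu> n)" for n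
    unfolding expected_spectral_measure_def
    by (intro prob_space.real_distribution_distr measure_pmf.prob_space_axioms) simp
  have M: "real_distribution M" and conv: "weak_conv_m ?\<mu> M"
    using lim by (auto simp: limiting_spectral_measure_def spectral_weak_limit_in_expectation_def)
  have large: "eventually (\<lambda>n. real n \<ge> c) sequentially"
    by real_asymp
  have int: "eventually (\<lambda>n. integrable (?\<mu> n) (\<lambda>x. x ^ k)) sequentially" for k
    using large by eventually_elim (rule expected_spectral_measure_moment(1)[OF c])
  have tends: "(\<lambda>n. LINT x|?\<mu> n. x ^ k) \<longlonglongrightarrow> ?L k" for k
  proof (rule Lim_transform_eventually)
    show "(\<lambda>n. (1 / sqrt c) ^ k * ((\<Sum>r<n. walk_weight n (c / real n) r k {} r) / real n)) \<longlonglongrightarrow> ?L k"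
      using c by (intro tendsto_mult_left tendsto_average_walk_weight) simp
    show "eventually (\<lambda>n. (1 / sqrt c) ^ k * ((\<Sum>r<n. walk_weight n (c / real n) r k {} r) / real n) =
        (LINT x|?\<mu> n. x ^ k)) sequentially"
      using large by eventually_elim (rule expected_spectral_measure_moment(2)[OF c, symmetric])
  qed
  show "integrable M (\<lambda>x. x ^ k)"
    by (rule weak_limit_integrable_power[OF distr M conv int tends])
  have "moment k M = ?L k"
    unfolding moment_def by (rule weak_limit_moment[OF distr M conv int tends])
  also have "\<dots> = tree_walks 1 (1 / c) k [] (\<lambda>_. 0)"
    using tree_walks_rescale[OF c, of "[]" k "\<lambda>_. 0"] c by (simp add: power_one_over)
  finally show "moment k M = tree_walks 1 (1 / c) k [] (\<lambda>_. 0)" .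
qed

theorem theorem1:
  fixes \<mu> :: "real \<Rightarrow> real measure"
  assumes "\<And>c. c > 0 \<Longrightarrow> limiting_spectral_measure c (\<mu> c)"
  shows "signed_moment 0 semicircle_correction_density = 0 \<and>
    (\<forall>k::nat.
      (\<forall>c>0. integrable (\<mu> c) (\<lambda>x. x ^ k)) \<and>
      has_signed_moment k semicircle_density \<and>
      has_signed_moment k semicircle_correction_density \<and>
      (\<lambda>c::real. moment k (\<mu> c)
         - signed_moment k (\<lambda>x. semicircle_density x + 1 / c * semicircle_correction_density x))
        \<in> o[at_top](\<lambda>c. 1 / c))"
proof (intro conjI allI impI)
  show "signed_moment 0 semicircle_correction_density = 0"
    by (simp add: correction_moment(2) cos_coeff_0)
  fix k
  show "has_signed_moment k semicircle_density" "has_signed_moment k semicircle_correction_density"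
    by (fact semicircle_moment(1) correction_moment(1))+
  show "integrable (\<mu> c) (\<lambda>x. x ^ k)" if "c > 0" for c
    by (rule moment_limiting_spectral_measure(1)[OF that assms[OF that]])
  have sum: "signed_moment k (\<lambda>x. semicircle_density x + 1 / c * semicircle_correction_density x) =
      (cos_coeff k 0 - cos_coeff k 2) + 1 / c * cos_coeff k 4" for c
  proof -
    have "x ^ k * (semicircle_density x + 1 / c * semicircle_correction_density x) =
        x ^ k * semicircle_density x + 1 / c * (x ^ k * semicircle_correction_density x)" for x
      by (simp add: algebra_simps)
    then have "signed_moment k (\<lambda>x. semicircle_density x + 1 / c * semicircle_correction_density x) =
        signed_moment k semicircle_density + 1 / c * signed_moment k semicircle_correction_density"
      using semicircle_moment(1)[of k] correction_moment(1)[of k]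
      unfolding signed_moment_def has_signed_moment_def by simp
    then show ?thesis by (simp only: semicircle_moment(2) correction_moment(2))
  qed
  \<comment> \<open>The moments are identified only for \<open>c > 0\<close>, which is enough for
    asymptotics at infinity.\<close>
  have "eventually (\<lambda>c. moment k (\<mu> c)
      - signed_moment k (\<lambda>x. semicircle_density x + 1 / c * semicircle_correction_density x) =
      tree_walks 1 (1 / c) k [] (\<lambda>_. 0) - (cos_coeff k 0 - cos_coeff k 2) - 1 / c * cos_coeff k 4) at_top"
    using eventually_gt_at_top[of 0]
  proof eventually_elim
    case (elim c)
    then show ?case
      using moment_limiting_spectral_measure(2)[OF elim assms[OF elim], of k] sum[of c] by simp
  qed
  then show "(\<lambda>c. moment k (\<mu> c)
      - signed_moment k (\<lambda>x. semicircle_density x + 1 / c * semicircle_correction_density x))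
      \<in> o[at_top](\<lambda>c. 1 / c)"
    using root_tree_walks_expansion[of k] by (subst landau_o.small.in_cong)
qed

end
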